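(* Given $(\beta,\alpha)\in\Delta$, there exists a sequence $\{(\beta_n,\alpha_n)\}_{n\in\mathbb{N}}$ in $\Delta$ with $\lim_{n\to\infty}(\beta_n,\alpha_n)=(\beta,\alpha)$ and such that (i) $\Omega_{\beta_n,\alpha_n}$ is a subshift of finite type for every $n$, (ii) the Hausdorff distance between $\Omega_{\beta,\alpha}$ and $\Omega_{\beta_n,\alpha_n}$ converges to zero as $n$ tends to infinity, and (iii) $\Omega_{\beta_n,\alpha_n}\subseteq\Omega_{\beta,\alpha}$ for every $n$.
   Context: $\Delta=\{(b,a)\in\mathbb{R}^2\colon b\in(1,2),\ a\in[0,2-b]\}$. For $(\beta,\alpha)\in\Delta$, $T_{\beta,\alpha}\colon[0,1]\to[0,1]$, $T_{\beta,\alpha}(x)=\beta x+\alpha\bmod 1$, and $p_{\beta,\alpha}=(1-\alpha)/\beta$. The upper expansion $\tau^{+}_{\beta,\alpha}(x)=\omega_1\omega_2\cdots\in\{0,1\}^{\mathbb{N}}$ of $x$ is defined by $\omega_n=0$ if $T_{\beta,\alpha}^{n-1}(x)<p_{\beta,\alpha}$ and $\omega_n=1$ otherwise; the lower expansion is $\tau^{-}_{\beta,\alpha}(x)=\lim_{y\nearrow x}\tau^{+}_{\beta,\alpha}(y)$. Set $\Omega^{+}_{\beta,\alpha}=\tau^{+}_{\beta,\alpha}([0,1))$, $\Omega^{-}_{\beta,\alpha}=\tau^{-}_{\beta,\alpha}((0,1])$ and $\Omega_{\beta,\alpha}=\Omega^{+}_{\beta,\alpha}\cup\Omega^{-}_{\beta,\alpha}$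 (the intermediate $\beta$-shift, which is a closed shift-invariant subset of $\{0,1\}^{\mathbb{N}}$). The Hausdorff distance is taken with respect to the metric $\mathscr{D}$ on $\{0,1\}^{\mathbb{N}}$ with $\mathscr{D}(\omega,\nu)=0$ if $\omega=\nu$ and $\mathscr{D}(\omega,\nu)=2^{-|\omega\wedge\nu|+1}$ otherwise, where $|\omega\wedge\nu|=\min\{n\in\mathbb{N}\colon\omega_n\ne\nu_n\}$. A subshift is of finite type if it is the set of all sequences in $\{0,1\}^{\mathbb{N}}$ in which no word of some finite set $F$ of forbidden finite words occurs. *)

theory Defs
  imports "HOL-Analysis.Analysis"
begin

text \<open>
  Infinite words \<open>\<omega>\<^sub>1\<omega>\<^sub>2\<dots>\<close> over \<open>{0,1}\<close> are functions \<open>nat \<Rightarrow> nat\<close> with values in \<open>{0,1}\<close>,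
  indexed from 0: the letter \<open>\<omega>\<^sub>n\<close> is \<open>\<omega> (n - 1)\<close>.
\<close>

definition full_shift :: "(nat \<Rightarrow> nat) set" where
  "full_shift = {\<omega>. \<forall>n. \<omega> n \<in> {0, 1}}"

definition param_region :: "(real \<times> real) set" where
  "param_region = {(b, a). b \<in> {1<..<2} \<and> a \<in> {0..2 - b}}"

definition beta_map :: "real \<Rightarrow> real \<Rightarrow> real \<Rightarrow> real" where
  "beta_map \<beta> \<alpha> x = frac (\<beta> * x + \<alpha>)"

definition crit_point :: "real \<Rightarrow> real \<Rightarrow> real" where
  "crit_point \<beta> \<alpha> = (1 - \<alpha>) / \<beta>"

definition upper_expansion :: "real \<Rightarrow> real \<Rightarrow> real \<Rightarrow> nat \<Rightarrow> nat" where
  "upper_expansion \<beta> \<alpha> x =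
     (\<lambda>n. if (beta_map \<beta> \<alpha> ^^ n) x < crit_point \<beta> \<alpha> then 0 else 1)"

text \<open>
  The limit is taken in the product topology on \<open>nat \<Rightarrow> nat\<close>; on \<open>full_shift\<close> this is the
  topology of \<open>shift_dist\<close> below. For \<open>(\<beta>, \<alpha>)\<close> in \<open>param_region\<close> and \<open>0 < x \<le> 1\<close> it exists
  and is unique. (\<open>Lim\<close> is unavailable: \<open>nat \<Rightarrow> nat\<close> is not declared an instance of \<open>t2_space\<close>.)
\<close>

definition lower_expansion :: "real \<Rightarrow> real \<Rightarrow> real \<Rightarrow> nat \<Rightarrow> nat" where
  "lower_expansion \<beta> \<alpha> x = (THE \<omega>. (upper_expansion \<beta> \<alpha> \<longlongrightarrow> \<omega>) (at_left x))"

definition beta_shift :: "real \<Rightarrow> real \<Rightarrow> (nat \<Rightarrow> nat) set" where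
  "beta_shift \<beta> \<alpha> =
     upper_expansion \<beta> \<alpha> ` {0..<1} \<union> lower_expansion \<beta> \<alpha> ` {0<..1}"

text \<open>
  With letters numbered from 1 the distance is \<open>2 ^ (1 - k)\<close>, where \<open>k\<close> is the first position of
  disagreement; numbering from 0 absorbs the shift by one in the exponent.
\<close>

definition shift_dist :: "(nat \<Rightarrow> nat) \<Rightarrow> (nat \<Rightarrow> nat) \<Rightarrow> real" where
  "shift_dist \<omega> \<nu> = (if \<omega> = \<nu> then 0 else 1 / 2 ^ (LEAST n. \<omega> n \<noteq> \<nu> n))"

text \<open>
  All suprema and infima are over subsets of \<open>{0..1}\<close>, hence genuine for nonempty sets of words.
\<close>

definition hausdorff_dist :: "(nat \<Rightarrow> nat) set \<Rightarrow> (nat \<Rightarrow> nat) set \<Rightarrow> real" where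
  "hausdorff_dist A B =
     max (SUP \<omega>\<in>A. INF \<nu>\<in>B. shift_dist \<omega> \<nu>) (SUP \<nu>\<in>B. INF \<omega>\<in>A. shift_dist \<omega> \<nu>)"

definition occurs_in :: "nat list \<Rightarrow> (nat \<Rightarrow> nat) \<Rightarrow> bool" where
  "occurs_in w \<omega> \<longleftrightarrow> (\<exists>k. \<forall>i<length w. \<omega> (k + i) = w ! i)"

text \<open>
  Closedness and shift-invariance need not be required separately: every set of the form below
  has both properties.
\<close>

definition subshift_of_finite_type :: "(nat \<Rightarrow> nat) set \<Rightarrow> bool" where
  "subshift_of_finite_type X \<longleftrightarrow>
     (\<exists>F. finite F \<and> (\<forall>w\<in>F. set w \<subseteq> {0, 1}) \<and>
          X = {\<omega> \<in> full_shift. \<forall>w\<in>F. \<not> occurs_in w \<omega>})"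

end

theory Submission
  imports Defs
begin

text \<open>
  The shift \<open>\<Omega>\<close> consists of the words all of whose shifts lie lexicographically between the upper
  expansion \<open>u\<close> of \<open>0\<close> and the lower expansion \<open>v\<close> of \<open>1\<close>. So \<open>\<Omega>\<close> is of finite type once \<open>u\<close> and \<open>v\<close> are
  periodic, that is, once the orbits of \<open>0\<close> and \<open>1\<close> hit the discontinuity, and raising \<open>u\<close> while
  lowering \<open>v\<close> shrinks \<open>\<Omega>\<close>. Moreover, the slope \<open>\<beta>\<close> is monotone in \<open>\<Omega>\<close>. To approximate \<open>(\<beta>, \<alpha>)\<close>, lower
  the slope and move along the curve of those parameters at which \<open>u\<close> is about to exceed its original
  value; as the slope drops, \<open>v\<close> must decrease. If the orbit of \<open>0\<close> never hits the discontinuity on this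
  curve, then \<open>u\<close> is constant there, so \<open>v\<close> is not, and therefore the orbit of \<open>1\<close> hits it somewhere. Having
  arranged one hit, follow the curve on which this hit persists: one of \<open>u\<close> and \<open>v\<close> is constant on it, so
  the other one is not, which forces the second hit.
\<close>

section \<open>Lexicographic order on sequences\<close>

definition lex_less :: "(nat \<Rightarrow> nat) \<Rightarrow> (nat \<Rightarrow> nat) \<Rightarrow> bool" where
  "lex_less v w \<longleftrightarrow> (\<exists>n. (\<forall>i<n. v i = w i) \<and> v n < w n)"

definition lex_le :: "(nat \<Rightarrow> nat) \<Rightarrow> (nat \<Rightarrow> nat) \<Rightarrow> bool" where
  "lex_le v w \<longleftrightarrow> v = w \<or> lex_less v w"

lemma first_difference:
  fixes v w :: "nat \<Rightarrow> 'a"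
  assumes "v \<noteq> w"
  obtains n where "\<forall>i<n. v i = w i" "v n \<noteq> w n"
proof -
  have "\<exists>n. v n \<noteq> w n" using assms by auto
  from LeastI_ex[OF this] not_less_Least[of _ "\<lambda>n. v n \<noteq> w n"] that show ?thesis by blast
qed

lemma lex_less_linear: "v \<noteq> w \<Longrightarrow> lex_less v w \<or> lex_less w v"
  by (elim first_difference) (metis lex_less_def linorder_neqE_nat)

lemma lex_less_asym: "lex_less v w \<Longrightarrow> \<not> lex_less w v"
  unfolding lex_less_def by (metis linorder_neqE_nat order_less_imp_not_less)

lemma lex_less_trans:
  assumes "lex_less u v" "lex_less v w" shows "lex_less u w"
proof -
  obtain m n where "\<forall>i<m. u i = v i" "u m < v m" "\<forall>i<n. v i = w i" "v n < w n"
    using assms unfolding lex_less_def by auto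
  then have "(\<forall>i<min m n. u i = w i) \<and> u (min m n) < w (min m n)"
    by (cases m n rule: linorder_cases) (auto simp: min_def)
  then show ?thesis unfolding lex_less_def by blast
qed

interpretation lex: linorder lex_le lex_less
proof
  fix u v w :: "nat \<Rightarrow> nat"
  show "lex_less u v \<longleftrightarrow> lex_le u v \<and> \<not> lex_le v u"
    using lex_less_asym unfolding lex_le_def by blast
  show "lex_le u u" by (simp add: lex_le_def)
  show "lex_le u v \<Longrightarrow> lex_le v w \<Longrightarrow> lex_le u w"
    using lex_less_trans unfolding lex_le_def by blast
  show "lex_le u v \<Longrightarrow> lex_le v u \<Longrightarrow> u = v"
    using lex_less_asym unfolding lex_le_def by blast
  show "lex_le u v \<or> lex_le v u"
    using lex_less_linear unfolding lex_le_def by blast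
qed

text \<open>A strict comparison is decided at the first disagreement \<open>n\<close>, so it carries
  over to every word with the same digits up to \<open>n\<close>.\<close>

lemma lex_less_cong_prefix:
  assumes "\<forall>i\<le>n. v i = v' i" "\<forall>i<n. v i = w i" "v n < w n"
  shows "lex_less v' w"
  using assms unfolding lex_less_def by (metis less_imp_le order.refl)

lemma lex_less_cong_prefix':
  assumes "\<forall>i\<le>n. w i = w' i" "\<forall>i<n. v i = w i" "v n < w n"
  shows "lex_less v w'"
  using assms unfolding lex_less_def by (metis less_imp_le order.refl)

definition shift :: "nat \<Rightarrow> (nat \<Rightarrow> nat) \<Rightarrow> nat \<Rightarrow> nat" where
  "shift n w = (\<lambda>i. w (n + i))"

lemma shift_0 [simp]: "shift 0 w = w"
  by (simp add: shift_def)

lemma shift_shift [simp]: "shift m (shift n w) = shift (n + m) w"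
  by (simp add: shift_def add.assoc)

lemma lex_less_shift_iff:
  assumes "\<forall>i<n. v i = w i"
  shows "lex_less (shift n v) (shift n w) \<longleftrightarrow> lex_less v w"
proof
  assume "lex_less (shift n v) (shift n w)"
  then obtain m where m: "\<forall>i<m. v (n + i) = w (n + i)" "v (n + m) < w (n + m)"
    unfolding lex_less_def shift_def by auto
  have "v i = w i" if "i < n + m" for i
    using assms m(1) that by (cases "i < n") (auto dest: spec[of _ "i - n"])
  with m(2) show "lex_less v w" unfolding lex_less_def by blast
next
  assume "lex_less v w"
  then obtain m where m: "\<forall>i<m. v i = w i" "v m < w m"
    unfolding lex_less_def by auto
  with assms have "n \<le> m" by (metis linorder_not_less order_less_irrefl)
  with m have "(\<forall>i<m-n. shift n v i = shift n w i) \<and> shift n v (m-n) < shift n w (m-n)"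
    by (auto simp: shift_def)
  then show "lex_less (shift n v) (shift n w)" unfolding lex_less_def by blast
qed

lemma lex_between_prefix:
  assumes "lex_le u v" "lex_le v w" "\<forall>i<n. u i = w i" "i < n"
  shows "v i = u i"
proof (rule ccontr)
  assume "v i \<noteq> u i"
  then have "v \<noteq> u" by auto
  then obtain m where m: "\<forall>j<m. v j = u j" "v m \<noteq> u m" by (rule first_difference)
  have "\<not> i < m" using m(1) \<open>v i \<noteq> u i\<close> by blast
  with \<open>i < n\<close> have "m < n" by linarith
  have "\<not> v m < u m"
    using m assms(1) lex.leD unfolding lex_less_def by blast
  moreover have "\<not> w m < v m"
  proof
    assume "w m < v m"
    moreover have "\<forall>j<m. w j = v j" using m assms(3) \<open>m < n\<close> by auto
    ultimately show False using assms(2) lex.leD unfolding lex_less_def by blast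
  qed
  ultimately show False using m assms(3) \<open>m < n\<close> by auto
qed

section \<open>Complementation of binary words\<close>

definition flip :: "(nat \<Rightarrow> nat) \<Rightarrow> nat \<Rightarrow> nat" where
  "flip w = (\<lambda>n. 1 - w n)"

lemma full_shiftD: "w \<in> full_shift \<Longrightarrow> w n = 0 \<or> w n = 1"
  by (auto simp: full_shift_def)

lemma flip_full_shift [simp]: "flip w \<in> full_shift"
  by (auto simp: full_shift_def flip_def)

lemma flip_flip: "w \<in> full_shift \<Longrightarrow> flip (flip w) = w"
proof
  fix n assume "w \<in> full_shift"
  then show "flip (flip w) n = w n" using full_shiftD[of w n] by (auto simp: flip_def)
qed

lemma flip_eq_iff:
  assumes "v \<in> full_shift" "w \<in> full_shift"
  shows "flip v n = flip w n \<longleftrightarrow> v n = w n" "flip v n < flip w n \<longleftrightarrow> w n < v n"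
  using full_shiftD[OF assms(1), of n] full_shiftD[OF assms(2), of n] by (auto simp: flip_def)

lemma lex_less_flip:
  assumes "v \<in> full_shift" "w \<in> full_shift"
  shows "lex_less (flip v) (flip w) \<longleftrightarrow> lex_less w v"
  unfolding lex_less_def by (simp add: flip_eq_iff[OF assms] eq_commute)

lemma lex_le_flip:
  assumes "v \<in> full_shift" "w \<in> full_shift"
  shows "lex_le (flip v) (flip w) \<longleftrightarrow> lex_le w v"
  using lex_less_flip[OF assms(2,1)] by (meson lex.not_less)

lemma shift_flip: "shift n (flip w) = flip (shift n w)"
  by (simp add: shift_def flip_def)

lemma shift_full_shift: "w \<in> full_shift \<Longrightarrow> shift n w \<in> full_shift"
  by (auto simp: full_shift_def shift_def)

section \<open>Upper and lower expansions\<close>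

text \<open>An explicit two-branch form that agrees with \<open>beta_map\<close> on
  \<open>[0,1)\<close> for parameters in \<open>param_region\<close>; orbits become affine steps
  determined by the digits.\<close>

definition umap :: "real \<Rightarrow> real \<Rightarrow> real \<Rightarrow> real" where
  "umap b a x = (if b * x + a < 1 then b * x + a else b * x + a - 1)"

definition uexp :: "real \<Rightarrow> real \<Rightarrow> real \<Rightarrow> nat \<Rightarrow> nat" where
  "uexp b a x n = (if b * (umap b a ^^ n) x + a < 1 then 0 else 1)"

text \<open>The reflection \<open>x \<mapsto> 1 - x\<close> conjugates the map with parameters \<open>(b, a)\<close> to the one with
  parameters \<open>(b, 2 - b - a)\<close> and exchanges left and right limits.\<close>

definition lexp :: "real \<Rightarrow> real \<Rightarrow> real \<Rightarrow> nat \<Rightarrow> nat" where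
  "lexp b a x = flip (uexp b (2 - b - a) (1 - x))"

text \<open>The orbit under the left-continuous version of the map, which takes digit 0 at the
  discontinuity and sends it to 1 instead of 0.\<close>

definition lorbit :: "real \<Rightarrow> real \<Rightarrow> real \<Rightarrow> nat \<Rightarrow> real" where
  "lorbit b a x n = 1 - (umap b (2 - b - a) ^^ n) (1 - x)"

lemma param_regionD:
  assumes "(b, a) \<in> param_region"
  shows "1 < b" "b < 2" "0 \<le> a" "a + b \<le> 2"
  using assms by (auto simp: param_region_def)

lemma param_regionI: "1 < b \<Longrightarrow> b < 2 \<Longrightarrow> 0 \<le> a \<Longrightarrow> a + b \<le> 2 \<Longrightarrow> (b, a) \<in> param_region"
  by (auto simp: param_region_def)

lemma param_region_reflect:
  "(b, a) \<in> param_region \<Longrightarrow> (b, 2 - b - a) \<in> param_region"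
  by (auto simp: param_region_def)

lemma uexp_full_shift [simp]: "uexp b a x \<in> full_shift"
  by (auto simp: full_shift_def uexp_def)

lemma lexp_full_shift [simp]: "lexp b a x \<in> full_shift"
  by (simp add: lexp_def)

lemma uexp_0_1: "uexp b a x n = 0 \<or> uexp b a x n = 1"
  by (simp add: uexp_def)

lemma umap_Suc: "(umap b a ^^ Suc n) x = b * (umap b a ^^ n) x + a - real (uexp b a x n)"
  by (simp add: umap_def uexp_def)

lemma uexp_reflect: "uexp b (2 - b - a) (1 - x) = flip (lexp b a x)"
  by (simp add: lexp_def flip_flip)

lemma lexp_reflect: "lexp b (2 - b - a) (1 - x) = flip (uexp b a x)"
  by (simp add: lexp_def)

lemma lorbit_0 [simp]: "lorbit b a x 0 = x"
  by (simp add: lorbit_def)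

lemma lexp_eq: "lexp b a x n = (if b * lorbit b a x n + a \<le> 1 then 0 else 1)"
  by (auto simp: lexp_def flip_def uexp_def lorbit_def algebra_simps)

lemma lorbit_Suc: "lorbit b a x (Suc n) = b * lorbit b a x n + a - real (lexp b a x n)"
  unfolding lorbit_def umap_Suc
  by (auto simp: lexp_def flip_def uexp_def algebra_simps)

lemma shift_uexp: "shift n (uexp b a x) = uexp b a ((umap b a ^^ n) x)"
proof
  fix i
  have "(umap b a ^^ (n + i)) x = (umap b a ^^ i) ((umap b a ^^ n) x)"
    by (metis add.commute comp_apply funpow_add)
  then show "shift n (uexp b a x) i = uexp b a ((umap b a ^^ n) x) i"
    by (simp add: shift_def uexp_def)
qed

lemma shift_lexp: "shift n (lexp b a x) = lexp b a (lorbit b a x n)"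
  by (simp add: lexp_def shift_flip shift_uexp lorbit_def)

lemma umap_in:
  assumes "(b, a) \<in> param_region" "0 \<le> x" "x < 1"
  shows "0 \<le> umap b a x" "umap b a x < 1"
proof -
  note p = param_regionD[OF assms(1)]
  have *: "b * x < b * 1" "0 \<le> b * x" using p assms by (auto intro!: mult_strict_left_mono)
  then show "0 \<le> umap b a x" "umap b a x < 1"
    using p by (cases "b * x + a < 1"; simp only: umap_def if_True if_False; linarith)+
qed

lemma uorbit_in:
  assumes "(b, a) \<in> param_region" "0 \<le> x" "x < 1"
  shows "0 \<le> (umap b a ^^ n) x \<and> (umap b a ^^ n) x < 1"
  by (induction n) (use assms umap_in in auto)

lemma lorbit_in:
  assumes "(b, a) \<in> param_region" "0 < x" "x \<le> 1"
  shows "0 < lorbit b a x n \<and> lorbit b a x n \<le> 1"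
  using uorbit_in[OF param_region_reflect[OF assms(1)], of "1 - x" n] assms by (simp add: lorbit_def)

text \<open>On \<open>[0,1)\<close> the value \<open>b * y + a\<close> lies in \<open>[0,2)\<close>
  because \<open>a + b \<le> 2\<close>, so the fractional part subtracts 0 or 1, as
  \<open>umap\<close> does.\<close>

lemma upper_expansion_eq_uexp:
  assumes "(b, a) \<in> param_region" "0 \<le> x" "x < 1"
  shows "upper_expansion b a x = uexp b a x"
proof -
  note p = param_regionD[OF assms(1)]
  have beta: "beta_map b a y = umap b a y" if "0 \<le> y" "y < 1" for y
  proof -
    have *: "b * y < b * 1" "0 \<le> b * y" using p that by (auto intro!: mult_strict_left_mono)
    show ?thesis
    proof (cases "b * y + a < 1")
      case True
      then show ?thesis using p * by (simp add: beta_map_def umap_def frac_eq)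
    next
      case False
      then have "0 \<le> b * y + a - 1" "b * y + a - 1 < 1" using p * by linarith+
      then have "frac (b * y + a - 1) = b * y + a - 1" by (subst frac_eq) blast
      moreover have "frac (b * y + a) = frac (b * y + a - 1)"
        using frac_1_eq[of "b * y + a - 1"] by simp
      ultimately show ?thesis using False by (simp add: beta_map_def umap_def)
    qed
  qed
  have orb: "(beta_map b a ^^ n) x = (umap b a ^^ n) x" for n
    by (induction n) (simp_all add: beta uorbit_in[OF assms])
  have "y < crit_point b a \<longleftrightarrow> b * y + a < 1" for y
    using p by (simp add: crit_point_def field_simps)
  then show ?thesis by (simp add: upper_expansion_def uexp_def fun_eq_iff orb)
qed

section \<open>Monotonicity and one-sided continuity\<close>

text \<open>The two inequalities between the parameters say that \<open>b x + a \<le> b' x + a'\<close> on the unit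
  interval.\<close>

lemma uorbit_mono:
  assumes "(b, a) \<in> param_region" "0 \<le> b'" "a \<le> a'" "a + b \<le> a' + b'"
    and "0 \<le> x" "x < 1" "x \<le> x'"
    and "\<forall>k<n. uexp b a x k = uexp b' a' x' k"
  shows "b * (umap b a ^^ n) x + a \<le> b' * (umap b' a' ^^ n) x' + a'"
    "(umap b a ^^ n) x \<le> (umap b' a' ^^ n) x'"
proof -
  have step: "b * y + a \<le> b' * y' + a'" if "0 \<le> y" "y < 1" "y \<le> y'" for y y'
  proof -
    have "b' * y' + a' - (b * y + a) =
        b' * (y' - y) + ((a' + b') - (a + b)) * y + (a' - a) * (1 - y)"
      by (simp add: algebra_simps)
    also have "\<dots> \<ge> 0" using assms that by (intro add_nonneg_nonneg mult_nonneg_nonneg) auto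
    finally show ?thesis by simp
  qed
  have *: "(umap b a ^^ k) x \<le> (umap b' a' ^^ k) x'" if "k \<le> n" for k
    using that
  proof (induction k)
    case 0
    show ?case using assms(7) by simp
  next
    case (Suc k)
    then show ?case
      using step[of "(umap b a ^^ k) x"] uorbit_in[OF assms(1,5,6), of k] assms(8)
      unfolding umap_Suc by simp
  qed
  then show "(umap b a ^^ n) x \<le> (umap b' a' ^^ n) x'" by simp
  then show "b * (umap b a ^^ n) x + a \<le> b' * (umap b' a' ^^ n) x' + a'"
    using step uorbit_in[OF assms(1,5,6), of n] by blast
qed

text \<open>Until the first disagreement the orbits stay ordered by \<open>uorbit_mono\<close>, so
  at that time the smaller one cannot be the one that has passed the discontinuity.\<close>

lemma uexp_mono:
  assumes "(b, a) \<in> param_region" "0 \<le> b'" "a \<le> a'" "a + b \<le> a' + b'"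
    and "0 \<le> x" "x < 1" "x \<le> x'"
  shows "lex_le (uexp b a x) (uexp b' a' x')"
proof (rule ccontr)
  assume "\<not> ?thesis"
  then obtain n where n: "\<forall>i<n. uexp b' a' x' i = uexp b a x i" "uexp b' a' x' n < uexp b a x n"
    by (auto simp: lex.not_le lex_less_def)
  then show False
    using uorbit_mono(1)[OF assms, of n] by (auto simp: uexp_def split: if_splits)
qed

text \<open>Reflection interchanges the two parameter inequalities and reverses the order, so this
  is \<open>uexp_mono\<close> with the two systems exchanged.\<close>

lemma lexp_mono:
  assumes "(b', a') \<in> param_region" "0 \<le> b" "a \<le> a'" "a + b \<le> a' + b'"
    and "x \<le> x'" "0 < x'" "x' \<le> 1"
  shows "lex_le (lexp b a x) (lexp b' a' x')"
  unfolding lexp_def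
  by (subst lex_le_flip; (intro uexp_mono param_region_reflect)?) (use assms in auto)

lemma uorbit_diff:
  assumes "\<forall>k<n. uexp b a x k = uexp b a y k"
  shows "(umap b a ^^ n) y - (umap b a ^^ n) x = b ^ n * (y - x)"
  using assms
proof (induction n)
  case (Suc n)
  then have "uexp b a x n = uexp b a y n"
    and *: "(umap b a ^^ n) y - (umap b a ^^ n) x = b ^ n * (y - x)" by auto
  then have "(umap b a ^^ Suc n) y - (umap b a ^^ Suc n) x
      = b * ((umap b a ^^ n) y - (umap b a ^^ n) x)"
    unfolding umap_Suc by (simp add: algebra_simps)
  then show ?case using * by simp
qed simp

text \<open>With equal expansions the distance of the orbits would grow like \<open>b ^ n\<close>,
  although both stay in the unit interval.\<close>

lemma uexp_inj:
  assumes "(b, a) \<in> param_region" "0 \<le> x" "x < y" "y < 1"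
  shows "uexp b a x \<noteq> uexp b a y"
proof
  assume eq: "uexp b a x = uexp b a y"
  have "1 < b" using assms param_regionD by blast
  then obtain n where "1 / (y - x) < b ^ n" using real_arch_pow by blast
  then have "1 < b ^ n * (y - x)" using assms by (simp add: field_simps)
  also have "\<dots> = (umap b a ^^ n) y - (umap b a ^^ n) x" using eq uorbit_diff[of n] by simp
  finally show False
    using uorbit_in[OF assms(1), of x n] uorbit_in[OF assms(1), of y n] assms by simp
qed

lemma uexp_strict_mono:
  assumes "(b, a) \<in> param_region" "0 \<le> x" "x < y" "y < 1"
  shows "lex_less (uexp b a x) (uexp b a y)"
  using uexp_mono[of b a b a x y] uexp_inj[OF assms] assms param_regionD(1)[OF assms(1)]
  by (auto simp: lex_le_def)

text \<open>Off the discontinuity each digit is decided by a strict inequality, which survives small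
  changes of the parameters and of the starting point. A general filter covers sequences, curves and
  one-sided limits.\<close>

lemma uexp_tendsto:
  fixes B A X :: "'c \<Rightarrow> real"
  assumes lim: "(B \<longlongrightarrow> b) F" "(A \<longlongrightarrow> a) F" "(X \<longlongrightarrow> x) F"
    and hit: "\<forall>k<n. b * (umap b a ^^ k) x + a \<noteq> 1"
  shows "((\<lambda>c. (umap (B c) (A c) ^^ n) (X c)) \<longlongrightarrow> (umap b a ^^ n) x) F"
    "eventually (\<lambda>c. \<forall>k<n. uexp (B c) (A c) (X c) k = uexp b a x k) F"
proof -
  have "((\<lambda>c. (umap (B c) (A c) ^^ n) (X c)) \<longlongrightarrow> (umap b a ^^ n) x) F \<and>
    eventually (\<lambda>c. \<forall>k<n. uexp (B c) (A c) (X c) k = uexp b a x k) F"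
    using hit
  proof (induction n)
    case 0
    show ?case using lim by simp
  next
    case (Suc n)
    then have IH: "((\<lambda>c. (umap (B c) (A c) ^^ n) (X c)) \<longlongrightarrow> (umap b a ^^ n) x) F"
      "eventually (\<lambda>c. \<forall>k<n. uexp (B c) (A c) (X c) k = uexp b a x k) F" by auto
    have f: "((\<lambda>c. B c * (umap (B c) (A c) ^^ n) (X c) + A c) \<longlongrightarrow> b * (umap b a ^^ n) x + a) F"
      by (intro tendsto_intros lim IH)
    have e: "eventually (\<lambda>c. uexp (B c) (A c) (X c) n = uexp b a x n) F"
    proof (cases "b * (umap b a ^^ n) x + a < 1")
      case True
      from order_tendstoD(2)[OF f True] show ?thesis by eventually_elim (use True in \<open>simp add: uexp_def\<close>)
    next
      case False
      with Suc.prems have *: "b * (umap b a ^^ n) x + a > 1" by force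
      from order_tendstoD(1)[OF f *] show ?thesis by eventually_elim (use * in \<open>simp add: uexp_def\<close>)
    qed
    have "((\<lambda>c. B c * (umap (B c) (A c) ^^ n) (X c) + A c - real (uexp b a x n)) \<longlongrightarrow>
        b * (umap b a ^^ n) x + a - real (uexp b a x n)) F"
      by (intro tendsto_intros f)
    then have "((\<lambda>c. (umap (B c) (A c) ^^ Suc n) (X c)) \<longlongrightarrow> (umap b a ^^ Suc n) x) F"
      unfolding umap_Suc by (rule Lim_transform_eventually) (use e in \<open>eventually_elim, simp\<close>)
    moreover from IH(2) e have "eventually (\<lambda>c. \<forall>k<Suc n. uexp (B c) (A c) (X c) k = uexp b a x k) F"
      by eventually_elim (auto simp: less_Suc_eq)
    ultimately show ?case by simp
  qed
  then show "((\<lambda>c. (umap (B c) (A c) ^^ n) (X c)) \<longlongrightarrow> (umap b a ^^ n) x) F"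
    "eventually (\<lambda>c. \<forall>k<n. uexp (B c) (A c) (X c) k = uexp b a x k) F" by auto
qed

text \<open>Under perturbations that raise the map and the point, hits are harmless: at a hit the
  digit is 1, and the perturbed orbit lies above by monotonicity, so it has digit 1 too.\<close>

lemma uexp_tendsto_right:
  fixes B A X :: "'c \<Rightarrow> real"
  assumes lim: "(B \<longlongrightarrow> b) F" "(A \<longlongrightarrow> a) F" "(X \<longlongrightarrow> x) F"
    and p: "(b, a) \<in> param_region" "0 \<le> x" "x < 1"
    and ev: "eventually (\<lambda>c. a \<le> A c \<and> a + b \<le> A c + B c \<and> x \<le> X c) F"
  shows "eventually (\<lambda>c. \<forall>k<n. uexp (B c) (A c) (X c) k = uexp b a x k) F"
proof -
  have "eventually (\<lambda>c. 0 < B c) F"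
    using order_tendstoD(1)[OF lim(1), of 0] param_regionD(1)[OF p(1)] by auto
  with ev have ev': "eventually (\<lambda>c. 0 \<le> B c \<and> a \<le> A c \<and> a + b \<le> A c + B c \<and> x \<le> X c) F"
    by eventually_elim auto
  have "((\<lambda>c. (umap (B c) (A c) ^^ n) (X c)) \<longlongrightarrow> (umap b a ^^ n) x) F \<and>
    eventually (\<lambda>c. \<forall>k<n. uexp (B c) (A c) (X c) k = uexp b a x k) F"
  proof (induction n)
    case 0
    show ?case using lim by simp
  next
    case (Suc n)
    then have IH: "((\<lambda>c. (umap (B c) (A c) ^^ n) (X c)) \<longlongrightarrow> (umap b a ^^ n) x) F"
      "eventually (\<lambda>c. \<forall>k<n. uexp (B c) (A c) (X c) k = uexp b a x k) F" by auto
    have f: "((\<lambda>c. B c * (umap (B c) (A c) ^^ n) (X c) + A c) \<longlongrightarrow> b * (umap b a ^^ n) x + a) F"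
      by (intro tendsto_intros lim IH)
    have e: "eventually (\<lambda>c. uexp (B c) (A c) (X c) n = uexp b a x n) F"
    proof (cases "b * (umap b a ^^ n) x + a < 1")
      case True
      from order_tendstoD(2)[OF f True] show ?thesis by eventually_elim (use True in \<open>simp add: uexp_def\<close>)
    next
      case False
      from ev' IH(2) show ?thesis
      proof eventually_elim
        case (elim c)
        then have "b * (umap b a ^^ n) x + a \<le> B c * (umap (B c) (A c) ^^ n) (X c) + A c"
          by (intro uorbit_mono p) auto
        with False show ?case by (simp add: uexp_def)
      qed
    qed
    have "((\<lambda>c. B c * (umap (B c) (A c) ^^ n) (X c) + A c - real (uexp b a x n)) \<longlongrightarrow>
        b * (umap b a ^^ n) x + a - real (uexp b a x n)) F"
      by (intro tendsto_intros f)
    then have "((\<lambda>c. (umap (B c) (A c) ^^ Suc n) (X c)) \<longlongrightarrow> (umap b a ^^ Suc n) x) F"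
      unfolding umap_Suc by (rule Lim_transform_eventually) (use e in \<open>eventually_elim, simp\<close>)
    moreover from IH(2) e have "eventually (\<lambda>c. \<forall>k<Suc n. uexp (B c) (A c) (X c) k = uexp b a x k) F"
      by eventually_elim (auto simp: less_Suc_eq)
    ultimately show ?case by simp
  qed
  then show ?thesis by simp
qed

lemma uexp_at_left:
  assumes p: "(b, a) \<in> param_region"
  shows "eventually (\<lambda>y. \<forall>k<n. uexp b a y k = lexp b a x k) (at_left x)"
proof -
  have b: "b > 0" using param_regionD(1)[OF p] by simp
  \<comment> \<open>The induction carries a strict inequality: if the lower orbit hits the
    discontinuity, the approaching orbits are strictly below it and also have digit 0.\<close>
  have "((\<lambda>y. (umap b a ^^ n) y) \<longlongrightarrow> lorbit b a x n) (at_left x) \<and>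
    eventually (\<lambda>y. (\<forall>k<n. uexp b a y k = lexp b a x k) \<and> (umap b a ^^ n) y < lorbit b a x n) (at_left x)"
  proof (induction n)
    case 0
    show ?case by (simp add: eventually_at_filter)
  next
    case (Suc n)
    then have IH: "((\<lambda>y. (umap b a ^^ n) y) \<longlongrightarrow> lorbit b a x n) (at_left x)"
      "eventually (\<lambda>y. (\<forall>k<n. uexp b a y k = lexp b a x k) \<and> (umap b a ^^ n) y < lorbit b a x n) (at_left x)"
      by auto
    have f: "((\<lambda>y. b * (umap b a ^^ n) y + a) \<longlongrightarrow> b * lorbit b a x n + a) (at_left x)"
      by (intro tendsto_intros IH)
    have e: "eventually (\<lambda>y. uexp b a y n = lexp b a x n) (at_left x)"
    proof (cases "b * lorbit b a x n + a \<le> 1")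
      case True
      from IH(2) show ?thesis
      proof eventually_elim
        case (elim y)
        then have "b * (umap b a ^^ n) y < b * lorbit b a x n" using b by simp
        then show ?case using True by (simp add: uexp_def lexp_eq)
      qed
    next
      case False
      then have *: "b * lorbit b a x n + a > 1" by simp
      from order_tendstoD(1)[OF f *] show ?thesis
        by eventually_elim (use * in \<open>simp add: uexp_def lexp_eq\<close>)
    qed
    have "((\<lambda>y. b * (umap b a ^^ n) y + a - real (lexp b a x n)) \<longlongrightarrow>
        b * lorbit b a x n + a - real (lexp b a x n)) (at_left x)"
      by (intro tendsto_intros f)
    then have "((\<lambda>y. (umap b a ^^ Suc n) y) \<longlongrightarrow> lorbit b a x (Suc n)) (at_left x)"
      unfolding umap_Suc lorbit_Suc
      by (rule Lim_transform_eventually) (use e in \<open>eventually_elim, simp\<close>)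
    moreover from IH(2) e have "eventually (\<lambda>y. (\<forall>k<Suc n. uexp b a y k = lexp b a x k) \<and>
        (umap b a ^^ Suc n) y < lorbit b a x (Suc n)) (at_left x)"
      unfolding umap_Suc lorbit_Suc by eventually_elim (use b in \<open>auto simp: less_Suc_eq\<close>)
    ultimately show ?case by simp
  qed
  then have "eventually (\<lambda>y. (\<forall>k<n. uexp b a y k = lexp b a x k) \<and>
    (umap b a ^^ n) y < lorbit b a x n) (at_left x)" by simp
  then show ?thesis by eventually_elim simp
qed

lemma tendsto_sequence_iff:
  fixes f :: "'c \<Rightarrow> nat \<Rightarrow> nat"
  shows "(f \<longlongrightarrow> w) F \<longleftrightarrow> (\<forall>i. eventually (\<lambda>c. f c i = w i) F)"
proof -
  have "(f \<longlongrightarrow> w) F \<longleftrightarrow> limitin (product_topology (\<lambda>i. euclidean) UNIV) f w F"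
    by (simp add: euclidean_product_topology)
  also have "\<dots> \<longleftrightarrow> (\<forall>i. ((\<lambda>c. f c i) \<longlongrightarrow> w i) F)"
    unfolding limitin_componentwise by simp
  also have "\<dots> \<longleftrightarrow> (\<forall>i. eventually (\<lambda>c. f c i = w i) F)"
    by (simp add: nhds_discrete filterlim_principal)
  finally show ?thesis .
qed

lemma lower_expansion_eq_lexp:
  assumes p: "(b, a) \<in> param_region" "0 < x" "x \<le> 1"
  shows "lower_expansion b a x = lexp b a x"
proof -
  have ev: "eventually (\<lambda>y. upper_expansion b a y i = lexp b a x i) (at_left x)" for i
  proof -
    have "eventually (\<lambda>y. 0 < y \<and> y < x) (at_left x)"
      using p(2) by (auto intro!: eventually_at_leftI[of 0])
    with uexp_at_left[OF p(1), of "Suc i" x] show ?thesis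
      by eventually_elim (use p upper_expansion_eq_uexp[OF p(1)] in auto)
  qed
  then have lim: "(upper_expansion b a \<longlongrightarrow> lexp b a x) (at_left x)"
    unfolding tendsto_sequence_iff by blast
  have "w = lexp b a x" if "(upper_expansion b a \<longlongrightarrow> w) (at_left x)" for w
  proof
    fix i
    have "eventually (\<lambda>y. upper_expansion b a y i = w i) (at_left x)"
      using that unfolding tendsto_sequence_iff by blast
    with ev[of i] have "eventually (\<lambda>y. w i = lexp b a x i) (at_left x)"
      by eventually_elim simp
    then show "w i = lexp b a x i" by simp
  qed
  with lim show ?thesis unfolding lower_expansion_def by blast
qed

section \<open>The shift is determined by the expansions of the end points\<close>

text \<open>The admissible words of a Lorenz map with given bounding words. Inclusions between
  shifts and the finite type property can be read off from \<open>u\<close> and \<open>v\<close>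
  alone.\<close>

definition kneading_shift :: "(nat \<Rightarrow> nat) \<Rightarrow> (nat \<Rightarrow> nat) \<Rightarrow> (nat \<Rightarrow> nat) set" where
  "kneading_shift u v = {w \<in> full_shift. \<forall>n. lex_le u (shift n w) \<and> lex_le (shift n w) v}"

lemma uexp_at_right:
  assumes "(b, a) \<in> param_region" "0 \<le> x" "x < 1"
  shows "eventually (\<lambda>y. \<forall>k<n. uexp b a y k = uexp b a x k) (at_right x)"
  by (rule uexp_tendsto_right[OF tendsto_const tendsto_const _ assms])
    (auto simp: eventually_at_filter)

text \<open>\<open>lexp b a 1\<close> is the limit of the increasing words \<open>uexp b a y\<close>
  as \<open>y\<close> tends to 1 from below; a violation would show in a finite prefix, hence at
  some \<open>y\<close> between \<open>x\<close> and 1.\<close>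

lemma uexp_le_lexp_1:
  assumes p: "(b, a) \<in> param_region" and x: "0 \<le> x" "x < 1"
  shows "lex_le (uexp b a x) (lexp b a 1)"
proof (rule ccontr)
  assume "\<not> ?thesis"
  then obtain n where n: "\<forall>i<n. lexp b a 1 i = uexp b a x i" "lexp b a 1 n < uexp b a x n"
    by (auto simp: lex.not_le lex_less_def)
  have "eventually (\<lambda>y. x < y \<and> y < 1) (at_left 1)"
    using x by (auto intro!: eventually_at_leftI[of x])
  with uexp_at_left[OF p, of "Suc n" 1]
  have "eventually (\<lambda>y. (\<forall>k<Suc n. uexp b a y k = lexp b a 1 k) \<and> x < y \<and> y < 1) (at_left 1)"
    by eventually_elim auto
  then obtain y where y: "\<forall>k<Suc n. uexp b a y k = lexp b a 1 k" "x < y" "y < 1"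
    using eventually_happens by fastforce
  have "lex_less (uexp b a y) (uexp b a x)"
    by (rule lex_less_cong_prefix[OF _ n]) (use y in auto)
  with uexp_strict_mono[OF p x(1) y(2,3)] show False by (simp add: lex.less_asym)
qed

lemma uexp_0_le_lexp:
  assumes p: "(b, a) \<in> param_region" and x: "0 < x" "x \<le> 1"
  shows "lex_le (uexp b a 0) (lexp b a x)"
proof -
  have "lex_le (uexp b (2 - b - a) (1 - x)) (lexp b (2 - b - a) 1)"
    using uexp_le_lexp_1[OF param_region_reflect[OF p], of "1 - x"] x by simp
  then have "lex_le (flip (lexp b (2 - b - a) 1)) (flip (uexp b (2 - b - a) (1 - x)))"
    by (simp add: lex_le_flip)
  then show ?thesis
    using lexp_reflect[of b a 0] by (simp add: flip_flip uexp_reflect)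
qed

lemma uexp_in_kneading_shift:
  assumes p: "(b, a) \<in> param_region" and x: "0 \<le> x" "x < 1"
  shows "uexp b a x \<in> kneading_shift (uexp b a 0) (lexp b a 1)"
  using uorbit_in[OF assms] uexp_le_lexp_1[OF p] uexp_mono[of b a b a 0] param_regionD(1)[OF p] p
  by (auto simp: kneading_shift_def shift_uexp)

lemma lexp_in_kneading_shift:
  assumes p: "(b, a) \<in> param_region" and x: "0 < x" "x \<le> 1"
  shows "lexp b a x \<in> kneading_shift (uexp b a 0) (lexp b a 1)"
  using lorbit_in[OF assms] uexp_0_le_lexp[OF p] lexp_mono[of b a b a _ 1] param_regionD(1)[OF p] p
  by (auto simp: kneading_shift_def shift_lexp)

text \<open>If both expansions of \<open>x\<close> differ, then they first do so when the orbit of \<open>x\<close> hits the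
  discontinuity, and they continue with the expansions of \<open>1\<close> and \<open>0\<close>, respectively.\<close>

lemma expansions_first_difference:
  assumes "\<forall>i<k. lexp b a x i = uexp b a x i" "lexp b a x k < uexp b a x k"
  shows "shift (Suc k) (uexp b a x) = uexp b a 0" "shift (Suc k) (lexp b a x) = lexp b a 1"
    "lexp b a x k = 0" "uexp b a x k = 1"
proof -
  have "lorbit b a x i = (umap b a ^^ i) x" if "i \<le> k" for i
    using that
  proof (induction i)
    case (Suc i)
    then show ?case using assms(1) unfolding umap_Suc lorbit_Suc by simp
  qed simp
  then have eq: "lorbit b a x k = (umap b a ^^ k) x" by simp
  show d: "lexp b a x k = 0" "uexp b a x k = 1"
    using assms(2) uexp_0_1[of b a x k] by auto
  have "b * lorbit b a x k + a \<le> 1" "b * (umap b a ^^ k) x + a \<ge> 1"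
    using d by (auto simp: lexp_eq uexp_def split: if_splits)
  with eq have one: "b * lorbit b a x k + a = 1" "b * (umap b a ^^ k) x + a = 1" by auto
  show "shift (Suc k) (uexp b a x) = uexp b a 0"
    unfolding shift_uexp umap_Suc d one by simp
  show "shift (Suc k) (lexp b a x) = lexp b a 1"
    unfolding shift_lexp lorbit_Suc d one by simp
qed

text \<open>For the supremum \<open>x\<close> of the points with upper expansion at most
  \<open>w\<close>, one-sided continuity puts \<open>w\<close> between the lower and the upper
  expansion of \<open>x\<close>. These differ only if the orbit of \<open>x\<close> hits the
  discontinuity, and admissibility leaves no room for a third word between them.\<close>

lemma kneading_shift_representation:
  assumes p: "(b, a) \<in> param_region"
    and w: "w \<in> kneading_shift (uexp b a 0) (lexp b a 1)"
  obtains x where "0 \<le> x" "x < 1" "w = uexp b a x" | x where "0 < x" "x \<le> 1" "w = lexp b a x"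
proof -
  have wf: "w \<in> full_shift" and wn: "lex_le (uexp b a 0) (shift n w)" "lex_le (shift n w) (lexp b a 1)" for n
    using w by (auto simp: kneading_shift_def)
  define S where "S = {y. 0 \<le> y \<and> y < 1 \<and> lex_le (uexp b a y) w}"
  define x where "x = Sup S"
  have S0: "0 \<in> S" using wn[of 0] by (simp add: S_def)
  have bdd: "bdd_above S" by (rule bdd_aboveI[of _ 1]) (auto simp: S_def)
  have x01: "0 \<le> x" "x \<le> 1"
    unfolding x_def using S0 bdd by (auto intro: cSup_upper cSup_least simp: S_def)
  have right: "lex_le w (uexp b a x)" if "x < 1"
  proof (rule ccontr)
    assume "\<not> ?thesis"
    then obtain n where n: "\<forall>i<n. uexp b a x i = w i" "uexp b a x n < w n"
      by (auto simp: lex.not_le lex_less_def)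
    have "eventually (\<lambda>y. x < y \<and> y < 1) (at_right x)"
      using that by (auto intro!: eventually_at_rightI[of _ 1])
    with uexp_at_right[OF p x01(1) that, of "Suc n"]
    have "eventually (\<lambda>y. (\<forall>k<Suc n. uexp b a y k = uexp b a x k) \<and> x < y \<and> y < 1) (at_right x)"
      by eventually_elim auto
    then obtain y where y: "\<forall>k<Suc n. uexp b a y k = uexp b a x k" "x < y" "y < 1"
      using eventually_happens by fastforce
    have "lex_less (uexp b a y) w"
      by (rule lex_less_cong_prefix[OF _ n]) (use y in auto)
    then have "y \<in> S" using y x01 by (simp add: S_def)
    then have "y \<le> x" unfolding x_def by (rule cSup_upper[OF _ bdd])
    with y show False by simp
  qed
  have left: "lex_le (lexp b a x) w" if "0 < x"
  proof (rule ccontr)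
    assume "\<not> ?thesis"
    then obtain n where n: "\<forall>i<n. w i = lexp b a x i" "w n < lexp b a x n"
      by (auto simp: lex.not_le lex_less_def)
    have "eventually (\<lambda>y. 0 < y \<and> y < x) (at_left x)"
      using that by (auto intro!: eventually_at_leftI[of 0])
    with uexp_at_left[OF p, of "Suc n" x]
    have "eventually (\<lambda>y. (\<forall>k<Suc n. uexp b a y k = lexp b a x k) \<and> 0 < y \<and> y < x) (at_left x)"
      by eventually_elim auto
    then obtain y where y: "\<forall>k<Suc n. uexp b a y k = lexp b a x k" "0 < y" "y < x"
      using eventually_happens by fastforce
    have less: "lex_less w (uexp b a y)"
      by (rule lex_less_cong_prefix'[OF _ n]) (use y in auto)
    obtain s where s: "s \<in> S" "y < s"
      using y(3) unfolding x_def by (subst (asm) less_cSup_iff) (use S0 bdd in auto)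
    then have "lex_less (uexp b a y) (uexp b a s)"
      using y by (intro uexp_strict_mono[OF p]) (auto simp: S_def)
    with s less show False by (auto simp: S_def)
  qed
  consider "x = 0" | "x = 1" | "0 < x" "x < 1" using x01 by linarith
  then show thesis
  proof cases
    case 1
    with right wn(1)[of 0] have "w = uexp b a 0" by (simp add: lex.order.antisym)
    with that(1)[of 0] show thesis by simp
  next
    case 2
    with left wn(2)[of 0] have "w = lexp b a 1" by (simp add: lex.order.antisym)
    with that(2)[of 1] show thesis by simp
  next
    case 3
    show thesis
    proof (cases "w = uexp b a x \<or> w = lexp b a x")
      case True
      with that(1)[of x] that(2)[of x] 3 show thesis by linarith
    next
      case False
      with left right 3 have less: "lex_less (lexp b a x) w" "lex_less w (uexp b a x)"
        by (auto simp: lex_le_def)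
      then have "lex_less (lexp b a x) (uexp b a x)" by (rule lex_less_trans)
      then obtain k where k: "\<forall>i<k. lexp b a x i = uexp b a x i" "lexp b a x k < uexp b a x k"
        unfolding lex_less_def by auto
      note d = expansions_first_difference[OF k]
      have pre: "\<forall>i<k. w i = lexp b a x i"
        using lex_between_prefix[OF lex.less_imp_le[OF less(1)] lex.less_imp_le[OF less(2)] k(1)]
        by simp
      \<comment> \<open>Through time \<open>k\<close> the word \<open>w\<close> follows one of the
        two expansions, so its remainder would lie above the expansion of 1 or below that of
        0.\<close>
      show thesis
      proof (cases "w k = 0")
        case True
        then have "\<forall>i<Suc k. lexp b a x i = w i" using pre d by (auto simp: less_Suc_eq)
        with less have "lex_less (lexp b a 1) (shift (Suc k) w)"
          using lex_less_shift_iff[of "Suc k" "lexp b a x" w] d by simp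
        with wn(2)[of "Suc k"] show thesis by (simp add: lex.not_less[symmetric])
      next
        case False
        with full_shiftD[OF wf, of k] have "w k = 1" by simp
        then have "\<forall>i<Suc k. w i = uexp b a x i" using pre d k(1) by (auto simp: less_Suc_eq)
        with less have "lex_less (shift (Suc k) w) (uexp b a 0)"
          using lex_less_shift_iff[of "Suc k" w "uexp b a x"] d by simp
        with wn(1)[of "Suc k"] show thesis by (simp add: lex.not_less[symmetric])
      qed
    qed
  qed
qed

lemma beta_shift_eq_kneading_shift:
  assumes p: "(b, a) \<in> param_region"
  shows "beta_shift b a = kneading_shift (uexp b a 0) (lexp b a 1)"
proof -
  have "beta_shift b a = uexp b a ` {0..<1} \<union> lexp b a ` {0<..1}"
    unfolding beta_shift_def
    by (intro arg_cong2[where f = "(\<union>)"] image_cong)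
      (auto simp: upper_expansion_eq_uexp[OF p] lower_expansion_eq_lexp[OF p])
  also have "\<dots> = kneading_shift (uexp b a 0) (lexp b a 1)"
    using uexp_in_kneading_shift[OF p] lexp_in_kneading_shift[OF p]
    by (auto elim!: kneading_shift_representation[OF p])
  finally show ?thesis .
qed

lemma kneading_shift_mono:
  assumes "lex_le u u'" "lex_le v' v"
  shows "kneading_shift u' v' \<subseteq> kneading_shift u v"
  using assms unfolding kneading_shift_def by (auto intro: lex.order_trans)

section \<open>The slope is monotone in the kneading sequences\<close>

text \<open>The digits are prescribed instead of read off from the point, and the interval is
  closed, so that upper and lower orbits are covered by one notion.\<close>

definition orbit_of :: "real \<Rightarrow> real \<Rightarrow> (nat \<Rightarrow> nat) \<Rightarrow> (nat \<Rightarrow> real) \<Rightarrow> bool" where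
  "orbit_of b a w z \<longleftrightarrow> (\<forall>n. 0 \<le> z n \<and> z n \<le> 1 \<and> z (Suc n) = b * z n + a - real (w n))"

lemma orbit_of_shift: "orbit_of b a w z \<Longrightarrow> orbit_of b a (shift m w) (\<lambda>n. z (m + n))"
  by (simp add: orbit_of_def shift_def)

lemma orbit_of_diff:
  assumes "orbit_of b a w z" "orbit_of b a w' z'" "\<forall>k<n. w k = w' k"
  shows "z' n - z n = b ^ n * (z' 0 - z 0)"
  using assms(3)
proof (induction n)
  case (Suc n)
  then have "w n = w' n" by simp
  moreover have "z (Suc n) = b * z n + a - real (w n)" "z' (Suc n) = b * z' n + a - real (w' n)"
    using assms(1,2) by (simp_all add: orbit_of_def)
  ultimately have "z' (Suc n) - z (Suc n) = b * (z' n - z n)"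
    by (simp add: right_diff_distrib)
  with Suc show ?case by simp
qed simp

lemma orbit_of_unique:
  assumes "orbit_of b a w z" "orbit_of b a w z'" "1 < b"
  shows "z = z'"
proof
  fix n
  show "z n = z' n"
  proof (rule ccontr)
    assume "z n \<noteq> z' n"
    then have pos: "0 < \<bar>z' n - z n\<bar>" by simp
    obtain m where "1 / \<bar>z' n - z n\<bar> < b ^ m" using real_arch_pow[OF assms(3)] by blast
    with pos have "1 < b ^ m * \<bar>z' n - z n\<bar>" by (simp add: field_simps)
    also have "\<dots> = \<bar>z' (n + m) - z (n + m)\<bar>"
      using orbit_of_diff[OF orbit_of_shift[OF assms(1), of n] orbit_of_shift[OF assms(2), of n], of m]
        assms(3) by (simp add: abs_mult)
    also have "\<dots> \<le> 1"
      using assms(1,2) unfolding orbit_of_def by (smt (verit, best))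
    finally show False by simp
  qed
qed

text \<open>Points in the wrong order would remain so until the first different digit, where
  subtracting the larger digit from the smaller point widens the gap to more than 1.\<close>

lemma orbit_of_mono:
  assumes "orbit_of b a w z" "orbit_of b a w' z'" "lex_less w w'" "1 < b"
  shows "z 0 \<le> z' 0"
proof (rule ccontr)
  assume neg: "\<not> ?thesis"
  obtain k where k: "\<forall>i<k. w i = w' i" "w k < w' k"
    using assms(3) by (auto simp: lex_less_def)
  have "z' k - z k = b ^ k * (z' 0 - z 0)" by (rule orbit_of_diff[OF assms(1,2) k(1)])
  moreover have "b ^ k * (z 0 - z' 0) > 0" using neg assms(4) by simp
  ultimately have "z' k < z k" by (simp add: algebra_simps)
  then have "b * z' k < b * z k" using assms(4) by simp
  moreover have "real (w k) + 1 \<le> real (w' k)" using k(2) by linarith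
  ultimately have "z' (Suc k) + 1 < z (Suc k)"
    using assms(1,2) unfolding orbit_of_def by (smt (verit))
  moreover have "0 \<le> z' (Suc k)" "z (Suc k) \<le> 1" using assms(1,2) unfolding orbit_of_def by blast+
  ultimately show False by simp
qed

lemma orbit_of_uexp:
  assumes "(b, a) \<in> param_region" "0 \<le> x" "x < 1"
  shows "orbit_of b a (uexp b a x) (\<lambda>n. (umap b a ^^ n) x)"
  using uorbit_in[OF assms] by (auto simp: orbit_of_def umap_Suc less_imp_le simp del: funpow.simps)

lemma orbit_of_lexp:
  assumes "(b, a) \<in> param_region" "0 < x" "x \<le> 1"
  shows "orbit_of b a (lexp b a x) (\<lambda>n. lorbit b a x n)"
  using lorbit_in[OF assms] by (auto simp: orbit_of_def lorbit_Suc less_imp_le)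

lemma uexp_prefix_convex:
  assumes "(b, a) \<in> param_region" "0 \<le> x" "x \<le> y" "y \<le> z" "z < 1"
    and "\<forall>k<m. uexp b a x k = uexp b a z k"
  shows "\<forall>k<m. uexp b a y k = uexp b a x k"
proof -
  have "1 < b" using assms(1) param_regionD by blast
  with assms have "lex_le (uexp b a x) (uexp b a y)" "lex_le (uexp b a y) (uexp b a z)"
    by (auto intro!: uexp_mono)
  from lex_between_prefix[OF this assms(6)] show ?thesis by blast
qed

text \<open>On a short interval the first \<open>m\<close> digits take at most two values, so the midpoint
  shares its first \<open>m\<close> digits with one of the end points.\<close>

lemma uexp_midpoint_prefix:
  assumes p: "(b, a) \<in> param_region"
  obtains \<delta> where "\<delta> > 0"
    "\<And>x y. 0 \<le> x \<Longrightarrow> x < y \<Longrightarrow> y < 1 \<Longrightarrow> y - x < \<delta> \<Longrightarrow>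
      (\<forall>k<m. uexp b a x k = uexp b a ((x + y) / 2) k) \<or>
      (\<forall>k<m. uexp b a ((x + y) / 2) k = uexp b a y k)"
proof -
  define word where "word x = map (uexp b a x) [0..<m]" for x
  have word_eq: "word x = word y \<longleftrightarrow> (\<forall>k<m. uexp b a x k = uexp b a y k)" for x y
    by (auto simp: word_def list_eq_iff_nth_eq)
  define W where "W = word ` {0..<1}"
  have "finite {xs. set xs \<subseteq> {0, 1::nat} \<and> length xs = m}"
    by (rule finite_lists_length_eq) simp
  moreover have "W \<subseteq> {xs. set xs \<subseteq> {0, 1::nat} \<and> length xs = m}"
    using uexp_0_1 by (force simp: W_def word_def)
  ultimately have fin: "finite W" by (rule finite_subset[rotated])
  \<comment> \<open>By right continuity every prefix that occurs is shared by a nondegenerate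
    interval. The finitely many chosen intervals have a least length \<open>\<delta>\<close>, so
    none of them fits strictly between points closer than \<open>\<delta>\<close>.\<close>
  have "\<forall>w\<in>W. \<exists>cd. 0 \<le> fst cd \<and> fst cd < snd cd \<and> snd cd < 1 \<and> word (fst cd) = w \<and> word (snd cd) = w"
  proof
    fix w assume "w \<in> W"
    then obtain x where x: "0 \<le> x" "x < 1" "w = word x" by (auto simp: W_def)
    have "eventually (\<lambda>y. x < y \<and> y < 1) (at_right x)"
      using x by (auto intro!: eventually_at_rightI[of _ 1])
    with uexp_at_right[OF p x(1,2), of m]
    have "eventually (\<lambda>y. (\<forall>k<m. uexp b a y k = uexp b a x k) \<and> x < y \<and> y < 1) (at_right x)"
      by eventually_elim auto
    then obtain y where "\<forall>k<m. uexp b a y k = uexp b a x k" "x < y" "y < 1"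
      using eventually_happens by fastforce
    with x show "\<exists>cd. 0 \<le> fst cd \<and> fst cd < snd cd \<and> snd cd < 1 \<and> word (fst cd) = w \<and> word (snd cd) = w"
      by (intro exI[of _ "(x, y)"]) (simp add: word_eq)
  qed
  from bchoice[OF this] obtain cd where cd: "\<forall>w\<in>W. 0 \<le> fst (cd w) \<and> fst (cd w) < snd (cd w) \<and>
      snd (cd w) < 1 \<and> word (fst (cd w)) = w \<and> word (snd (cd w)) = w" by blast
  define \<delta> where "\<delta> = Min ((\<lambda>w. snd (cd w) - fst (cd w)) ` W)"
  have ne: "W \<noteq> {}" by (auto simp: W_def)
  have "\<delta> > 0" unfolding \<delta>_def using fin ne cd by (subst Min_gr_iff) auto
  moreover have "word x = word ((x + y) / 2) \<or> word ((x + y) / 2) = word y"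
    if xy: "0 \<le> x" "x < y" "y < 1" "y - x < \<delta>" for x y
  proof (rule ccontr)
    assume neg: "\<not> ?thesis"
    define z where "z = (x + y) / 2"
    have z: "x < z" "z < y" using xy by (auto simp: z_def)
    then have zW: "word z \<in> W" using xy by (auto simp: W_def)
    define c d where "c = fst (cd (word z))" and "d = snd (cd (word z))"
    have cd': "0 \<le> c" "c < d" "d < 1" "word c = word z" "word d = word z"
      using cd zW by (auto simp: c_def d_def)
    have "x < c"
    proof (rule ccontr)
      assume "\<not> x < c"
      then have "word x = word c"
        unfolding word_eq using cd' z xy
        by (intro uexp_prefix_convex[OF p, of c x z]) (auto simp: word_eq)
      with neg cd' show False by (simp add: z_def)
    qed
    moreover have "d < y"
    proof (rule ccontr)
      assume "\<not> d < y"
      then have "word y = word z"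
        unfolding word_eq using cd' z xy
        by (intro uexp_prefix_convex[OF p, of z y d]) (auto simp: word_eq)
      with neg show False by (simp add: z_def)
    qed
    moreover have "\<delta> \<le> d - c"
      unfolding \<delta>_def c_def d_def using fin zW by (intro Min_le) auto
    ultimately show False using xy by simp
  qed
  ultimately show thesis using that unfolding word_eq by blast
qed

text \<open>Were \<open>b\<^sub>1 < b\<^sub>2\<close>, then the map \<open>\<phi>\<close> sending \<open>x\<close> to the point of the first system with the same
  expansion would be increasing and bounded, and it would scale lengths by \<open>b\<^sub>1\<close> where the second
  system scales by \<open>b\<^sub>2\<close>. Passing from an interval to the image of one of its halves gains a factor
  \<open>(b\<^sub>2 / b\<^sub>1) ^ m / 2 > 1\<close>, so the difference quotients of \<open>\<phi>\<close> are arbitrarily large.\<close>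

lemma slope_le:
  assumes p1: "(b\<^sub>1, a\<^sub>1) \<in> param_region" and p2: "(b\<^sub>2, a\<^sub>2) \<in> param_region"
    and u: "lex_le (uexp b\<^sub>1 a\<^sub>1 0) (uexp b\<^sub>2 a\<^sub>2 0)" and v: "lex_le (lexp b\<^sub>2 a\<^sub>2 1) (lexp b\<^sub>1 a\<^sub>1 1)"
  shows "b\<^sub>2 \<le> b\<^sub>1"
proof (rule ccontr)
  assume "\<not> b\<^sub>2 \<le> b\<^sub>1"
  then have less: "b\<^sub>1 < b\<^sub>2" by simp
  have b1: "1 < b\<^sub>1" and b2: "1 < b\<^sub>2" using p1 p2 param_regionD by auto
  let ?e = "uexp b\<^sub>2 a\<^sub>2" and ?T = "umap b\<^sub>2 a\<^sub>2"
  \<comment> \<open>The bounding words put the second shift inside the first, so each of its words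
    is an expansion of some point of the first system.\<close>
  have "\<forall>x\<in>{0..<1}. \<exists>z. orbit_of b\<^sub>1 a\<^sub>1 (?e x) z \<and>
      ?e x \<in> {uexp b\<^sub>1 a\<^sub>1 (z 0), lexp b\<^sub>1 a\<^sub>1 (z 0)}"
  proof
    fix x :: real assume "x \<in> {0..<1}"
    then have "?e x \<in> kneading_shift (uexp b\<^sub>1 a\<^sub>1 0) (lexp b\<^sub>1 a\<^sub>1 1)"
      using uexp_in_kneading_shift[OF p2, of x] kneading_shift_mono[OF u v] by auto
    then show "\<exists>z. orbit_of b\<^sub>1 a\<^sub>1 (?e x) z \<and> ?e x \<in> {uexp b\<^sub>1 a\<^sub>1 (z 0), lexp b\<^sub>1 a\<^sub>1 (z 0)}"
    proof (rule kneading_shift_representation[OF p1])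
      fix y assume "0 \<le> y" "y < 1" "?e x = uexp b\<^sub>1 a\<^sub>1 y"
      then show ?thesis using orbit_of_uexp[OF p1, of y]
        by (intro exI[of _ "\<lambda>n. (umap b\<^sub>1 a\<^sub>1 ^^ n) y"]) simp
    next
      fix y assume "0 < y" "y \<le> 1" "?e x = lexp b\<^sub>1 a\<^sub>1 y"
      then show ?thesis using orbit_of_lexp[OF p1, of y]
        by (intro exI[of _ "lorbit b\<^sub>1 a\<^sub>1 y"]) simp
    qed
  qed
  from bchoice[OF this] obtain Z where "\<forall>x\<in>{0..<1}. orbit_of b\<^sub>1 a\<^sub>1 (?e x) (Z x) \<and>
      ?e x \<in> {uexp b\<^sub>1 a\<^sub>1 (Z x 0), lexp b\<^sub>1 a\<^sub>1 (Z x 0)}" by blast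
  then have Z:
    "\<And>x. 0 \<le> x \<Longrightarrow> x < 1 \<Longrightarrow> orbit_of b\<^sub>1 a\<^sub>1 (?e x) (Z x)"
    "\<And>x. 0 \<le> x \<Longrightarrow> x < 1 \<Longrightarrow> ?e x \<in> {uexp b\<^sub>1 a\<^sub>1 (Z x 0), lexp b\<^sub>1 a\<^sub>1 (Z x 0)}"
    by auto
  define \<phi> where "\<phi> x = Z x 0" for x
  have bounded: "0 \<le> \<phi> x" "\<phi> x \<le> 1" if "0 \<le> x" "x < 1" for x
    using Z(1)[OF that] by (auto simp: \<phi>_def orbit_of_def)
  have mono: "\<phi> x \<le> \<phi> y" if "0 \<le> x" "x < y" "y < 1" for x y
    unfolding \<phi>_def using that
    by (intro orbit_of_mono[OF Z(1) Z(1) uexp_strict_mono[OF p2] b1]) auto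
  \<comment> \<open>If \<open>\<phi>\<close> agreed at \<open>x\<close> and \<open>y\<close>, then
    also at the midpoint, and three distinct words would be expansions of a single point, which has
    only two.\<close>
  have strict: "\<phi> x < \<phi> y" if xy: "0 \<le> x" "x < y" "y < 1" for x y
  proof (rule ccontr)
    assume "\<not> ?thesis"
    define z where "z = (x + y) / 2"
    have z: "x < z" "z < y" using xy by (auto simp: z_def)
    with mono[of x z] mono[of z y] xy \<open>\<not> ?thesis\<close> have "\<phi> x = \<phi> z" "\<phi> z = \<phi> y" by auto
    then have "{?e x, ?e z, ?e y} \<subseteq> {uexp b\<^sub>1 a\<^sub>1 (\<phi> z), lexp b\<^sub>1 a\<^sub>1 (\<phi> z)}"
      using Z(2)[of x] Z(2)[of z] Z(2)[of y] xy z by (auto simp: \<phi>_def)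
    moreover have "?e x \<noteq> ?e z" "?e z \<noteq> ?e y" "?e x \<noteq> ?e y"
      using xy z uexp_inj[OF p2, of x z] uexp_inj[OF p2, of z y] uexp_inj[OF p2, of x y] by auto
    ultimately show False by auto
  qed
  \<comment> \<open>Orbits with prescribed digits are unique, so \<open>\<phi>\<close> sends an
    iterate of \<open>x\<close> to the corresponding point of the orbit \<open>Z x\<close>.\<close>
  have scale: "\<phi> ((?T ^^ m) y) - \<phi> ((?T ^^ m) x) = b\<^sub>1 ^ m * (\<phi> y - \<phi> x)"
    if "0 \<le> x" "x < 1" "0 \<le> y" "y < 1" "\<forall>k<m. ?e x k = ?e y k" for x y m
  proof -
    have *: "Z ((?T ^^ m) x) = (\<lambda>n. Z x (m + n))" if "0 \<le> x" "x < 1" for x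
      using orbit_of_shift[OF Z(1)[OF that], of m] uorbit_in[OF p2 that, of m]
      by (intro orbit_of_unique[OF Z(1) _ b1]) (auto simp: shift_uexp)
    show ?thesis
      unfolding \<phi>_def using *[of x] *[of y] orbit_of_diff[OF Z(1) Z(1) that(5)] that by simp
  qed
  \<comment> \<open>The power \<open>m\<close> makes the ratio of the two scalings exceed 2, which
    outweighs the loss from halving an interval.\<close>
  obtain m where "2 < (b\<^sub>2 / b\<^sub>1) ^ m" using real_arch_pow[of "b\<^sub>2 / b\<^sub>1" 2] less b1 by auto
  define l where "l = (b\<^sub>2 / b\<^sub>1) ^ m / 2"
  have l: "1 < l" using \<open>2 < _\<close> by (simp add: l_def)
  obtain \<delta> where \<delta>: "\<delta> > 0" and mid:
    "\<And>x y. 0 \<le> x \<Longrightarrow> x < y \<Longrightarrow> y < 1 \<Longrightarrow> y - x < \<delta> \<Longrightarrow>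
      (\<forall>k<m. ?e x k = ?e ((x + y) / 2) k) \<or> (\<forall>k<m. ?e ((x + y) / 2) k = ?e y k)"
    using uexp_midpoint_prefix[OF p2] by blast
  \<comment> \<open>The half whose end points share \<open>m\<close> digits is stretched by
    \<open>b\<^sub>2 ^ m\<close>; by monotonicity of \<open>\<phi>\<close> its increment of
    \<open>\<phi>\<close> is at most that of the whole interval.\<close>
  have short: "\<exists>x' y'. 0 \<le> x' \<and> x' < y' \<and> y' < 1 \<and> y' - x' = b\<^sub>2 ^ m / 2 * (y - x) \<and>
      \<phi> y' - \<phi> x' \<le> b\<^sub>1 ^ m * (\<phi> y - \<phi> x)"
    if xy: "0 \<le> x" "x < y" "y < 1" "y - x < \<delta>" for x y
  proof -
    define z where "z = (x + y) / 2"
    have z: "x < z" "z < y" using xy by (auto simp: z_def)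
    obtain c d where cd: "0 \<le> c" "c < d" "d < 1" "d - c = (y - x) / 2" "\<forall>k<m. ?e c k = ?e d k"
      "\<phi> d - \<phi> c \<le> \<phi> y - \<phi> x"
    proof (cases "\<forall>k<m. ?e x k = ?e z k")
      case True
      with that[of x z] xy z mono[of z y] show thesis by (auto simp: z_def field_simps)
    next
      case False
      with mid[OF xy] have "\<forall>k<m. ?e z k = ?e y k" by (auto simp: z_def)
      with that[of z y] xy z mono[of x z] show thesis by (auto simp: z_def field_simps)
    qed
    define x' y' where "x' = (?T ^^ m) c" and "y' = (?T ^^ m) d"
    have len: "y' - x' = b\<^sub>2 ^ m / 2 * (y - x)"
      unfolding x'_def y'_def using uorbit_diff[OF cd(5)] cd(4) by simp
    moreover have "0 < b\<^sub>2 ^ m / 2 * (y - x)" using b2 xy by simp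
    ultimately have "x' < y'" by linarith
    moreover have "\<phi> y' - \<phi> x' \<le> b\<^sub>1 ^ m * (\<phi> y - \<phi> x)"
      unfolding x'_def y'_def using cd b1 by (subst scale) auto
    ultimately show ?thesis
      using len uorbit_in[OF p2, of c m] uorbit_in[OF p2, of d m] cd
      unfolding x'_def y'_def by (intro exI[of _ "(?T ^^ m) c"] exI[of _ "(?T ^^ m) d"]) auto
  qed
  have gain: "c * l * (y - x) \<le> \<phi> y - \<phi> x"
    if "c * (y' - x') \<le> \<phi> y' - \<phi> x'" "y' - x' = b\<^sub>2 ^ m / 2 * (y - x)"
      "\<phi> y' - \<phi> x' \<le> b\<^sub>1 ^ m * (\<phi> y - \<phi> x)" for c x y x' y'
  proof -
    have "b\<^sub>2 ^ m / 2 = b\<^sub>1 ^ m * l" using b1 by (simp add: l_def power_divide)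
    with that have "b\<^sub>1 ^ m * (c * l * (y - x)) \<le> b\<^sub>1 ^ m * (\<phi> y - \<phi> x)"
      by (simp add: mult_ac)
    then show ?thesis using b1 by simp
  qed
  define P where "P c \<longleftrightarrow> (\<forall>x y. 0 \<le> x \<longrightarrow> x < y \<longrightarrow> y < 1 \<longrightarrow> c * (y - x) \<le> \<phi> y - \<phi> x)" for c
  \<comment> \<open>Short intervals gain the factor \<open>l\<close> from one application of
    \<open>short\<close>; longer ones are bisected until they are short, as the bound is
    additive.\<close>
  have step: "P (c * l)" if c: "P c" for c
  proof -
    have "c * l * (y - x) \<le> \<phi> y - \<phi> x"
      if "0 \<le> x" "x < y" "y < 1" "y - x < 2 ^ k * \<delta>" for k x y
      using that
    proof (induction k arbitrary: x y)
      case 0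
      then obtain x' y' where *: "0 \<le> x'" "x' < y'" "y' < 1" "y' - x' = b\<^sub>2 ^ m / 2 * (y - x)"
        "\<phi> y' - \<phi> x' \<le> b\<^sub>1 ^ m * (\<phi> y - \<phi> x)" using short[of x y] by auto
      then have "c * (y' - x') \<le> \<phi> y' - \<phi> x'" using c by (simp add: P_def)
      then show ?case by (rule gain) fact+
    next
      case (Suc k)
      define z where "z = (x + y) / 2"
      have "c * l * (z - x) \<le> \<phi> z - \<phi> x" "c * l * (y - z) \<le> \<phi> y - \<phi> z"
        using Suc.IH[of x z] Suc.IH[of z y] Suc.prems by (auto simp: z_def field_simps)
      moreover have "c * l * (y - x) = c * l * (z - x) + c * l * (y - z)"
        by (simp add: algebra_simps)
      ultimately show ?case by linarith
    qed
    moreover have "\<exists>k. y - x < 2 ^ k * \<delta>" for x y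
      using real_arch_pow[of 2 "(y - x) / \<delta>"] \<delta> by (auto simp: field_simps)
    ultimately show ?thesis unfolding P_def by blast
  qed
  \<comment> \<open>A first positive bound: an interval of length at least \<open>\<delta>\<close>
    contains a cell of the grid of mesh \<open>h\<close>, and a shorter one is stretched by
    \<open>short\<close> until it is that long.\<close>
  obtain c where c: "0 < c" "P c"
  proof -
    define h where "h = \<delta> / 2"
    define J where "J = {j::nat. real (j + 1) * h < 1}"
    have h: "h > 0" using \<delta> by (simp add: h_def)
    have "J \<subseteq> {..nat \<lceil>1 / h\<rceil>}"
    proof
      fix j assume "j \<in> J"
      then have "real (j + 1) * h < 1" by (simp add: J_def)
      then have "real j < 1 / h" using h by (simp add: field_simps)
      then show "j \<in> {..nat \<lceil>1 / h\<rceil>}" by (simp, linarith)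
    qed
    then have fin: "finite J" by (rule finite_subset) simp
    define c where "c = Min (insert 1 ((\<lambda>j. \<phi> (real (j + 1) * h) - \<phi> (real j * h)) ` J))"
    have jpos: "\<phi> (real j * h) < \<phi> (real (j + 1) * h)" if "j \<in> J" for j
      using that h by (intro strict) (auto simp: J_def)
    have c: "0 < c"
      unfolding c_def using fin jpos by (subst Min_gr_iff) auto
    have long: "c * (y - x) \<le> \<phi> y - \<phi> x" if xy: "0 \<le> x" "y < 1" "y - x \<ge> \<delta>" for x y
    proof -
      \<comment> \<open>The first grid point at or after \<open>x\<close>; the next one is still
        below \<open>y\<close> because \<open>\<delta>\<close> is twice the mesh.\<close>
      define j where "j = nat \<lceil>x / h\<rceil>"
      have "real j = of_int \<lceil>x / h\<rceil>" using xy h by (simp add: j_def)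
      then have "x / h \<le> real j" "real j < x / h + 1" by linarith+
      then have j: "x \<le> real j * h" "real j * h < x + h" using h by (simp_all add: field_simps)
      then have j1: "real (j + 1) * h < y" using xy by (simp add: h_def field_simps)
      then have jJ: "j \<in> J" using xy by (simp add: J_def)
      have "c \<le> \<phi> (real (j + 1) * h) - \<phi> (real j * h)"
        unfolding c_def using fin jJ by (intro Min_le) auto
      moreover have "\<phi> (real (j + 1) * h) \<le> \<phi> y" using mono j1 xy h by simp
      moreover have "\<phi> x \<le> \<phi> (real j * h)"
        using mono[of x "real j * h"] j j1 xy h by (cases "x = real j * h") (auto simp: field_simps)
      moreover have "c * (y - x) \<le> c" using c xy by (simp add: mult_left_le)
      ultimately show ?thesis by linarith
    qed
    have "c * (y - x) \<le> \<phi> y - \<phi> x"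
      if "0 \<le> x" "x < y" "y < 1" "\<delta> \<le> (y - x) * (b\<^sub>2 ^ m / 2) ^ k" for k x y
      using that
    proof (induction k arbitrary: x y)
      case 0
      then show ?case using long[of x y] by simp
    next
      case (Suc k)
      show ?case
      proof (cases "y - x < \<delta>")
        case True
        with Suc.prems obtain x' y' where *: "0 \<le> x'" "x' < y'" "y' < 1"
          "y' - x' = b\<^sub>2 ^ m / 2 * (y - x)"
          "\<phi> y' - \<phi> x' \<le> b\<^sub>1 ^ m * (\<phi> y - \<phi> x)" using short[of x y] by blast
        have "(y' - x') * (b\<^sub>2 ^ m / 2) ^ k = (y - x) * (b\<^sub>2 ^ m / 2) ^ Suc k"
          unfolding *(4) by simp
        then have "\<delta> \<le> (y' - x') * (b\<^sub>2 ^ m / 2) ^ k" using Suc.prems(4) by linarith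
        with * have "c * (y' - x') \<le> \<phi> y' - \<phi> x'" by (intro Suc.IH)
        then have "c * l * (y - x) \<le> \<phi> y - \<phi> x" by (rule gain) fact+
        moreover have "c * 1 * (y - x) \<le> c * l * (y - x)"
          using c l Suc.prems by (intro mult_mono) auto
        ultimately show ?thesis by linarith
      next
        case False
        with Suc.prems long[of x y] show ?thesis by simp
      qed
    qed
    moreover have "\<exists>k. \<delta> \<le> (y - x) * (b\<^sub>2 ^ m / 2) ^ k" if "x < y" for x y
    proof -
      have "1 * (b\<^sub>2 ^ m / 2) \<ge> l"
        using b1 b2 l by (simp add: l_def power_divide field_simps)
      with l have "1 < b\<^sub>2 ^ m / 2" by linarith
      from real_arch_pow[OF this, of "\<delta> / (y - x)"] show ?thesis
        using that by (auto simp: field_simps intro: less_imp_le)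
    qed
    ultimately have "P c" unfolding P_def by blast
    with c that show thesis by blast
  qed
  have P: "P (c * l ^ k)" for k
  proof (induction k)
    case (Suc k)
    from step[OF this] show ?case by (simp add: mult_ac)
  qed (use c in simp)
  have "c * l ^ k * (1 / 2) \<le> \<phi> (1 / 2) - \<phi> 0" for k
    using P[of k, unfolded P_def, rule_format, of 0 "1 / 2"] by simp
  then have "l ^ k \<le> 2 / c" for k
    using bounded[of 0] bounded[of "1/2"] c by (simp add: field_simps) (smt (verit))
  then show False using real_arch_pow[OF l, of "2 / c"] by (meson linorder_not_less)
qed

section \<open>Curves in the parameter space\<close>

text \<open>By reflection, \<open>hits b (2 - b - a)\<close> is the same condition for the lower
  orbit of 1.\<close>

definition hits :: "real \<Rightarrow> real \<Rightarrow> bool" where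
  "hits b a \<longleftrightarrow> (\<exists>n. b * (umap b a ^^ n) 0 + a = 1)"

text \<open>The right branch sends the discontinuity to 0, so after a hit the orbit starts
  over.\<close>

lemma shift_uexp_hit:
  assumes "b * (umap b a ^^ n) 0 + a = 1"
  shows "shift (Suc n) (uexp b a 0) = uexp b a 0" "uexp b a 0 n = 1"
proof -
  show 1: "uexp b a 0 n = 1" using assms by (simp add: uexp_def)
  show "shift (Suc n) (uexp b a 0) = uexp b a 0"
    unfolding shift_uexp umap_Suc 1 assms by simp
qed

lemma hits_imp_periodic: "hits b a \<Longrightarrow> \<exists>n. shift (Suc n) (uexp b a 0) = uexp b a 0"
  using shift_uexp_hit(1) unfolding hits_def by blast

lemma periodic_eqI:
  assumes "shift (Suc n) u = u" "shift (Suc n) v = v" "\<forall>k\<le>n. u k = v k"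
  shows "u = v"
proof
  fix k
  show "u k = v k"
  proof (induction k rule: less_induct)
    case (less k)
    show ?case
    proof (cases "k \<le> n")
      case False
      then obtain j where j: "k = Suc n + j" using less_eqE[of "Suc n" k] by auto
      then have "u k = u j" "v k = v j"
        using assms(1,2) by (auto simp: shift_def fun_eq_iff)
      with less[of j] j show ?thesis by simp
    qed (use assms in auto)
  qed
qed

lemma uexp_0_tendsto:
  fixes B A :: "'c \<Rightarrow> real"
  assumes "(B \<longlongrightarrow> b) F" "(A \<longlongrightarrow> a) F" "\<not> hits b a"
  shows "eventually (\<lambda>c. \<forall>k<n. uexp (B c) (A c) 0 k = uexp b a 0 k) F"
  using assms by (intro uexp_tendsto) (auto simp: hits_def)

text \<open>Otherwise both kneading sequences are constant along the curve, and so is the slope.\<close>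

lemma curve_hits:
  fixes c :: "real \<Rightarrow> real"
  assumes "l < r" and cont: "continuous_on {l<..<r} c"
    and p: "\<And>x. l < x \<Longrightarrow> x < r \<Longrightarrow> (x, c x) \<in> param_region"
    and u: "\<And>x. l < x \<Longrightarrow> x < r \<Longrightarrow> uexp x (c x) 0 = u"
  shows "\<exists>x. l < x \<and> x < r \<and> hits x (2 - x - c x)"
proof (rule ccontr)
  assume no: "\<not> ?thesis"
  define x y where "x = l + (r - l) / 3" and "y = l + (r - l) / 2"
  have xy: "l < x" "x < y" "y < r" using \<open>l < r\<close> by (auto simp: x_def y_def field_simps)
  \<comment> \<open>Without hits each digit of the expansion of 1 is locally constant along the
    curve, hence constant on the connected interval.\<close>
  have "uexp x (2 - x - c x) 0 n = uexp y (2 - y - c y) 0 n" for n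
  proof (rule connected_local_const[of "{l<..<r}" x y "\<lambda>z. uexp z (2 - z - c z) 0 n"])
    show "\<forall>z\<in>{l<..<r}. eventually (\<lambda>z'. uexp z (2 - z - c z) 0 n = uexp z' (2 - z' - c z') 0 n)
      (at z within {l<..<r})"
    proof
      fix z assume z: "z \<in> {l<..<r}"
      have c: "(c \<longlongrightarrow> c z) (at z within {l<..<r})"
        using cont z by (simp add: continuous_on_def)
      have "eventually (\<lambda>z'. \<forall>k<Suc n. uexp z' (2 - z' - c z') 0 k = uexp z (2 - z - c z) 0 k)
        (at z within {l<..<r})"
        by (rule uexp_0_tendsto) (use no z in \<open>auto intro!: tendsto_intros c\<close>)
      then show "eventually (\<lambda>z'. uexp z (2 - z - c z) 0 n = uexp z' (2 - z' - c z') 0 n)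
        (at z within {l<..<r})" by eventually_elim auto
    qed
  qed (use xy in auto)
  then have "uexp x (2 - x - c x) 0 = uexp y (2 - y - c y) 0" by blast
  then have "lexp x (c x) 1 = lexp y (c y) 1" by (simp add: lexp_def)
  moreover have "uexp x (c x) 0 = uexp y (c y) 0" using u xy by simp
  ultimately have "y \<le> x"
    using p xy by (intro slope_le[of x "c x" y "c y"]) auto
  with xy show False by simp
qed

text \<open>With \<open>c x\<close> nonincreasing and \<open>c x + x\<close> nondecreasing,
  \<open>c\<close> is 1-Lipschitz. Both curves below have this shape because orbits are monotone in
  \<open>a\<close> and \<open>a + b\<close>.\<close>

lemma continuous_on_of_monotone_bounds:
  fixes c :: "real \<Rightarrow> real"
  assumes "\<And>x y. x \<in> S \<Longrightarrow> y \<in> S \<Longrightarrow> x < y \<Longrightarrow> c y \<le> c x \<and> c x \<le> c y + (y - x)"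
  shows "continuous_on S c"
proof -
  have "dist (c x) (c y) \<le> dist x y" if "x \<in> S" "y \<in> S" for x y
    using assms[of x y] assms[of y x] that
    by (cases x y rule: linorder_cases) (auto simp: dist_real_def)
  then show ?thesis unfolding continuous_on_iff by (meson order.strict_trans1)
qed

text \<open>The parameters near \<open>(b\<^sub>1, a\<^sub>1)\<close> for which the orbit of \<open>0\<close> hits the discontinuity at the same
  time, with the same digits, form the graph of a function of the slope.\<close>

lemma hits_nearby:
  assumes p: "(b\<^sub>1, a\<^sub>1) \<in> param_region" and "hits b\<^sub>1 a\<^sub>1" and l: "1 \<le> l" "l < b\<^sub>1"
  obtains b a where "l < b" "b < b\<^sub>1" "a\<^sub>1 \<le> a" "a \<le> a\<^sub>1 + b\<^sub>1 - b" "hits b a" "hits b (2 - b - a)"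
    "uexp b a 0 = uexp b\<^sub>1 a\<^sub>1 0"
proof -
  note pD = param_regionD[OF p]
  define w where "w = uexp b\<^sub>1 a\<^sub>1 0"
  define n where "n = (LEAST n. b\<^sub>1 * (umap b\<^sub>1 a\<^sub>1 ^^ n) 0 + a\<^sub>1 = 1)"
  have n: "b\<^sub>1 * (umap b\<^sub>1 a\<^sub>1 ^^ n) 0 + a\<^sub>1 = 1"
    using \<open>hits b\<^sub>1 a\<^sub>1\<close> unfolding hits_def n_def by (rule LeastI_ex)
  have nless: "b\<^sub>1 * (umap b\<^sub>1 a\<^sub>1 ^^ k) 0 + a\<^sub>1 \<noteq> 1" if "k < n" for k
    using not_less_Least[OF that[unfolded n_def]] by simp
  \<comment> \<open>With the digits frozen at \<open>w\<close>, the orbit is continuous in the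
    parameters. Before the first hit the digits are decided by strict inequalities, so the condition
    \<open>E\<close> holds nearby and makes this the true orbit up to time \<open>n\<close>.\<close>
  define orb where "orb b a = rec_nat (0::real) (\<lambda>k r. b * r + a - real (w k))" for b a
  have orb_0: "orb b a 0 = 0" and orb_Suc: "orb b a (Suc k) = b * orb b a k + a - real (w k)" for b a k
    by (simp_all add: orb_def)
  have orb_base: "orb b\<^sub>1 a\<^sub>1 k = (umap b\<^sub>1 a\<^sub>1 ^^ k) 0" for k
    by (induction k) (simp add: orb_0, simp add: orb_Suc umap_Suc w_def del: funpow.simps)
  have orb_tendsto: "((\<lambda>x. orb (B x) (A x) k) \<longlongrightarrow> orb b a k) F"
    if "(B \<longlongrightarrow> b) F" "(A \<longlongrightarrow> a) F" for B A :: "'c \<Rightarrow> real" and b a k F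
    by (induction k) (auto simp: orb_0 orb_Suc intro!: tendsto_intros that)
  define E where "E b a \<longleftrightarrow> (\<forall>k\<in>{..<n}. if w k = 0 then b * orb b a k + a < 1 else 1 < b * orb b a k + a)"
    for b a
  have "eventually (\<lambda>x. E (fst x) (snd x)) (nhds (b\<^sub>1, a\<^sub>1))"
    unfolding E_def
  proof (rule eventually_ball_finite)
    show "\<forall>k\<in>{..<n}. eventually (\<lambda>x. if w k = 0 then fst x * orb (fst x) (snd x) k + snd x < 1
        else 1 < fst x * orb (fst x) (snd x) k + snd x) (nhds (b\<^sub>1, a\<^sub>1))"
    proof
      fix k assume k: "k \<in> {..<n}"
      have fs: "(fst \<longlongrightarrow> b\<^sub>1) (nhds (b\<^sub>1, a\<^sub>1))" "(snd \<longlongrightarrow> a\<^sub>1) (nhds (b\<^sub>1, a\<^sub>1))"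
        using tendsto_fst[OF filterlim_ident] tendsto_snd[OF filterlim_ident]
        by (metis fst_conv, metis snd_conv)
      have lim: "((\<lambda>x. fst x * orb (fst x) (snd x) k + snd x) \<longlongrightarrow> b\<^sub>1 * orb b\<^sub>1 a\<^sub>1 k + a\<^sub>1) (nhds (b\<^sub>1, a\<^sub>1))"
        by (intro tendsto_intros orb_tendsto fs)
      show "eventually (\<lambda>x. if w k = 0 then fst x * orb (fst x) (snd x) k + snd x < 1
          else 1 < fst x * orb (fst x) (snd x) k + snd x) (nhds (b\<^sub>1, a\<^sub>1))"
      proof (cases "w k = 0")
        case True
        then have "b\<^sub>1 * orb b\<^sub>1 a\<^sub>1 k + a\<^sub>1 < 1" by (simp add: w_def uexp_def orb_base split: if_splits)
        from order_tendstoD(2)[OF lim this] True show ?thesis by simp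
      next
        case False
        then have "b\<^sub>1 * orb b\<^sub>1 a\<^sub>1 k + a\<^sub>1 > 1"
          using nless[of k] k by (simp add: w_def uexp_def orb_base split: if_splits)
        from order_tendstoD(1)[OF lim this] False show ?thesis by simp
      qed
    qed
  qed simp
  then obtain d where d: "d > 0" "\<And>x. dist x (b\<^sub>1, a\<^sub>1) < d \<Longrightarrow> E (fst x) (snd x)"
    unfolding eventually_nhds_metric by blast
  \<comment> \<open>On the triangle \<open>R\<close> both \<open>b\<^sub>1 - b\<close> and
    \<open>a - a\<^sub>1\<close> are less than \<open>d / 2\<close>, so its points are within
    \<open>d\<close> of the base point.\<close>
  define l' where "l' = max l (b\<^sub>1 - d / 2)"
  have l': "l' < b\<^sub>1" "l \<le> l'" "1 \<le> l'" using l d by (auto simp: l'_def)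
  define R where "R b a \<longleftrightarrow> l' < b \<and> b \<le> b\<^sub>1 \<and> a\<^sub>1 \<le> a \<and> a \<le> a\<^sub>1 + b\<^sub>1 - b" for b a
  have R: "(b, a) \<in> param_region" "\<forall>k<n. uexp b a 0 k = w k" "orb b a n = (umap b a ^^ n) 0"
    if "R b a" for b a
  proof -
    have "dist (b, a) (b\<^sub>1, a\<^sub>1) \<le> \<bar>b - b\<^sub>1\<bar> + \<bar>a - a\<^sub>1\<bar>"
      by (simp add: dist_Pair_Pair dist_real_def sqrt_sum_squares_le_sum_abs)
    also have "\<dots> < d" using that by (auto simp: R_def l'_def)
    finally have "E b a" using d(2)[of "(b, a)"] by simp
    show "(b, a) \<in> param_region"
      using that l' pD by (intro param_regionI) (auto simp: R_def)
    have *: "orb b a k = (umap b a ^^ k) 0 \<and> (\<forall>i<k. uexp b a 0 i = w i)" if "k \<le> n" for k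
      using that
    proof (induction k)
      case (Suc k)
      then have IH: "orb b a k = (umap b a ^^ k) 0" "\<forall>i<k. uexp b a 0 i = w i" and k: "k < n" by auto
      have "uexp b a 0 k = w k"
      proof (cases "w k = 0")
        case True
        then have "b * (umap b a ^^ k) 0 + a < 1"
          using bspec[OF \<open>E b a\<close>[unfolded E_def], of k] k unfolding IH(1) by simp
        then show ?thesis unfolding uexp_def[of b a] using True by simp
      next
        case False
        then have "1 < b * (umap b a ^^ k) 0 + a"
          using bspec[OF \<open>E b a\<close>[unfolded E_def], of k] k unfolding IH(1) by simp
        moreover have "w k = 1" using False uexp_0_1[of b\<^sub>1 a\<^sub>1 0 k] by (simp add: w_def)
        ultimately show ?thesis unfolding uexp_def[of b a] by simp
      qed
      with IH show ?case unfolding umap_Suc by (auto simp: orb_Suc less_Suc_eq)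
    qed (simp add: orb_0)
    then show "\<forall>k<n. uexp b a 0 k = w k" "orb b a n = (umap b a ^^ n) 0" by auto
  qed
  \<comment> \<open>On \<open>R\<close> a hit at time \<open>n\<close> is the equation
    \<open>G b a = 1\<close>. It is solvable for each slope, as monotonicity gives
    \<open>G \<le> 1\<close> at \<open>a = a\<^sub>1\<close> and \<open>G \<ge> 1\<close> at
    \<open>a = a\<^sub>1 + b\<^sub>1 - b\<close>.\<close>
  define G where "G b a = b * orb b a n + a" for b a
  have G_mono: "G b a \<le> G b' a'" "orb b a n \<le> orb b' a' n"
    if "R b a" "R b' a'" "a \<le> a'" "a + b \<le> a' + b'" for b a b' a'
  proof -
    have "0 \<le> b'" using param_regionD(1)[OF R(1)[OF that(2)]] by simp
    moreover have "\<forall>k<n. uexp b a 0 k = uexp b' a' 0 k" using R(2) that(1,2) by simp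
    ultimately show "G b a \<le> G b' a'" "orb b a n \<le> orb b' a' n"
      unfolding G_def R(3)[OF that(1)] R(3)[OF that(2)]
      by (intro uorbit_mono R(1) that; simp)+
  qed
  have G_strict: "G b a < G b a'" if "R b a" "R b a'" "a < a'" for b a a'
  proof -
    have "b * orb b a n \<le> b * orb b a' n"
      using G_mono(2)[OF that(1,2)] that param_regionD(1)[OF R(1)[OF that(1)]]
      by (intro mult_left_mono) auto
    with that show ?thesis by (simp add: G_def)
  qed
  have G1: "G b\<^sub>1 a\<^sub>1 = 1" using n by (simp add: G_def orb_base)
  have R1: "R b\<^sub>1 a\<^sub>1" using l' by (simp add: R_def)
  have "\<forall>b\<in>{l'<..<b\<^sub>1}. \<exists>a. R b a \<and> G b a = 1"
  proof
    fix b assume b: "b \<in> {l'<..<b\<^sub>1}"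
    have "continuous_on {a\<^sub>1..a\<^sub>1 + b\<^sub>1 - b} (G b)"
      unfolding G_def continuous_on_def by (auto intro!: tendsto_intros orb_tendsto)
    moreover have "G b a\<^sub>1 \<le> 1" unfolding G1[symmetric]
      using b R1 by (intro G_mono) (auto simp: R_def)
    moreover have "1 \<le> G b (a\<^sub>1 + b\<^sub>1 - b)" unfolding G1[symmetric]
      using b R1 by (intro G_mono) (auto simp: R_def)
    ultimately obtain a where "a\<^sub>1 \<le> a" "a \<le> a\<^sub>1 + b\<^sub>1 - b" "G b a = 1"
      using IVT'[of "G b" a\<^sub>1 1 "a\<^sub>1 + b\<^sub>1 - b"] b by auto
    with b show "\<exists>a. R b a \<and> G b a = 1" by (auto simp: R_def)
  qed
  from bchoice[OF this] obtain c where "\<forall>b\<in>{l'<..<b\<^sub>1}. R b (c b) \<and> G b (c b) = 1"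
    by blast
  then have c: "\<And>b. l' < b \<Longrightarrow> b < b\<^sub>1 \<Longrightarrow> R b (c b)"
    "\<And>b. l' < b \<Longrightarrow> b < b\<^sub>1 \<Longrightarrow> G b (c b) = 1" by auto
  have hit: "b * (umap b (c b) ^^ n) 0 + c b = 1" if "l' < b" "b < b\<^sub>1" for b
    using c(2)[OF that] R(3)[OF c(1)[OF that]] by (simp add: G_def)
  \<comment> \<open>A hit at time \<open>n\<close> gives both words the period \<open>n + 1\<close>,
    and they agree on it: the digits before \<open>n\<close> are stable and digit \<open>n\<close>
    is 1.\<close>
  have u: "uexp b (c b) 0 = w" if b: "l' < b" "b < b\<^sub>1" for b
  proof (rule periodic_eqI)
    show "shift (Suc n) (uexp b (c b) 0) = uexp b (c b) 0" "shift (Suc n) w = w"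
      using shift_uexp_hit(1)[OF hit[OF b]] shift_uexp_hit(1)[OF n] by (auto simp: w_def)
    show "\<forall>k\<le>n. uexp b (c b) 0 k = w k"
      using R(2)[OF c(1)[OF b]] shift_uexp_hit(2)[OF hit[OF b]] shift_uexp_hit(2)[OF n]
      by (auto simp: w_def le_less)
  qed
  have "continuous_on {l'<..<b\<^sub>1} c"
  proof (rule continuous_on_of_monotone_bounds)
    fix b b' assume b: "b \<in> {l'<..<b\<^sub>1}" "b' \<in> {l'<..<b\<^sub>1}" "b < b'"
    then have Rb: "R b (c b)" "G b (c b) = 1" "R b' (c b')" "G b' (c b') = 1" using c by auto
    have "c b' \<le> c b"
    proof (rule ccontr)
      assume "\<not> ?thesis"
      moreover have "R b (c b')" using Rb b by (auto simp: R_def)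
      moreover from this have "G b (c b') \<le> G b' (c b')" using Rb b by (intro G_mono) auto
      ultimately show False using G_strict[OF Rb(1)] Rb by force
    qed
    moreover have "c b \<le> c b' + (b' - b)"
    proof (rule ccontr)
      assume neg: "\<not> ?thesis"
      have "R b (c b' + (b' - b))" using Rb b by (auto simp: R_def)
      moreover from this have "G b' (c b') \<le> G b (c b' + (b' - b))"
        using Rb b by (intro G_mono) auto
      ultimately show False using G_strict[OF _ Rb(1), of "c b' + (b' - b)"] neg Rb by force
    qed
    ultimately show "c b' \<le> c b \<and> c b \<le> c b' + (b' - b)" by simp
  qed
  from curve_hits[OF l'(1) this R(1)[OF c(1)] u]
  obtain b where b: "l' < b" "b < b\<^sub>1" "hits b (2 - b - c b)" by blast
  show thesis
  proof (rule that[of b "c b"])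
    show "l < b" "b < b\<^sub>1" "hits b (2 - b - c b)" using b l' by auto
    show "a\<^sub>1 \<le> c b" "c b \<le> a\<^sub>1 + b\<^sub>1 - b" using c(1)[OF b(1,2)] by (auto simp: R_def)
    show "hits b (c b)" using hit b unfolding hits_def by blast
    show "uexp b (c b) 0 = uexp b\<^sub>1 a\<^sub>1 0" using u b by (simp add: w_def)
  qed
qed

text \<open>Along the curve \<open>c\<close> the lower end of the shift is raised; since the slope has decreased,
  the upper end cannot be raised as well.\<close>

lemma curve_exists:
  assumes p: "(b\<^sub>0, a\<^sub>0) \<in> param_region" and l: "1 \<le> l" "l < b\<^sub>0"
  shows "\<exists>c. continuous_on {l<..<b\<^sub>0} c \<and> (\<forall>x. l < x \<longrightarrow> x < b\<^sub>0 \<longrightarrow>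
    a\<^sub>0 \<le> c x \<and> c x \<le> a\<^sub>0 + b\<^sub>0 - x \<and>
    lex_le (uexp b\<^sub>0 a\<^sub>0 0) (uexp x (c x) 0) \<and> lex_le (lexp x (c x) 1) (lexp b\<^sub>0 a\<^sub>0 1) \<and>
    (\<not> hits x (c x) \<longrightarrow> uexp x (c x) 0 = uexp b\<^sub>0 a\<^sub>0 0))"
proof -
  note pD = param_regionD[OF p]
  define u where "u = uexp b\<^sub>0 a\<^sub>0 0"
  define v where "v = lexp b\<^sub>0 a\<^sub>0 1"
  \<comment> \<open>The supremum of \<open>S x\<close> is where the expansion of 0 is about to
    exceed \<open>u\<close>. The strip between constant \<open>a\<close> and constant
    \<open>a + b\<close> makes the expansions comparable with \<open>u\<close> at its edges.\<close>
  define S where "S x = {a. a\<^sub>0 \<le> a \<and> a \<le> a\<^sub>0 + b\<^sub>0 - x \<and> lex_le (uexp x a 0) u}" for x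
  define c where "c x = Sup (S x)" for x
  have region: "(x, a) \<in> param_region" if "l < x" "x < b\<^sub>0" "a\<^sub>0 \<le> a" "a \<le> a\<^sub>0 + b\<^sub>0 - x" for x a
    using that l pD by (intro param_regionI) auto
  have bdd: "bdd_above (S x)" for x by (rule bdd_aboveI[of _ "a\<^sub>0 + b\<^sub>0 - x"]) (auto simp: S_def)
  have mem: "a\<^sub>0 \<in> S x" if x: "l < x" "x < b\<^sub>0" for x
    unfolding S_def u_def using x l pD by (auto intro!: uexp_mono region)
  have c: "a\<^sub>0 \<le> c x" "c x \<le> a\<^sub>0 + b\<^sub>0 - x" if x: "l < x" "x < b\<^sub>0" for x
  proof -
    show "a\<^sub>0 \<le> c x" unfolding c_def using mem[OF x] by (rule cSup_upper[OF _ bdd])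
    have "S x \<noteq> {}" using mem[OF x] by blast
    then show "c x \<le> a\<^sub>0 + b\<^sub>0 - x" unfolding c_def by (rule cSup_least) (simp add: S_def)
  qed
  have approx: "\<exists>a\<in>S x. P a"
    if x: "l < x" "x < b\<^sub>0" and nS: "c x \<notin> S x" and P: "eventually P (at_left (c x))" for x P
  proof -
    have "c x \<noteq> a\<^sub>0" using mem[OF x] nS by auto
    then have "a\<^sub>0 < c x" using c[OF x] by simp
    then obtain e where e: "e < c x" "\<And>a. e < a \<Longrightarrow> a < c x \<Longrightarrow> P a"
      using P unfolding eventually_at_left[OF \<open>a\<^sub>0 < c x\<close>] by blast
    obtain a where a: "a \<in> S x" "e < a"
      using e(1) unfolding c_def by (subst (asm) less_cSup_iff) (use mem[OF x] bdd in auto)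
    moreover have "a \<le> c x" unfolding c_def using a(1) by (rule cSup_upper[OF _ bdd])
    moreover have "a \<noteq> c x" using a nS by auto
    ultimately show ?thesis using e(2)[of a] by force
  qed
  \<comment> \<open>With the expansion of 0 at most \<open>u\<close>, an expansion of 1 at least
    \<open>v\<close> would force a slope of at least \<open>b\<^sub>0\<close>.\<close>
  have slope: "lex_less (lexp x a 1) v" if "l < x" "x < b\<^sub>0" "a \<in> S x" for x a
  proof (rule ccontr)
    assume "\<not> ?thesis"
    then have "lex_le v (lexp x a 1)" by simp
    then have "b\<^sub>0 \<le> x"
      using that unfolding v_def u_def S_def by (intro slope_le[OF region p, of x a]) auto
    with that show False by simp
  qed
  \<comment> \<open>By right continuity in \<open>a\<close>, an expansion of 0 below
    \<open>u\<close> at \<open>c x\<close> would stay below \<open>u\<close> slightly beyond; at the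
    edge of the strip monotonicity gives the bound.\<close>
  have upper: "lex_le u (uexp x (c x) 0)" if x: "l < x" "x < b\<^sub>0" for x
  proof (rule ccontr)
    assume neg: "\<not> ?thesis"
    then obtain N where N: "\<forall>i<N. uexp x (c x) 0 i = u i" "uexp x (c x) 0 N < u N"
      by (auto simp: lex.not_le lex_less_def)
    have "c x \<noteq> a\<^sub>0 + b\<^sub>0 - x"
    proof
      assume "c x = a\<^sub>0 + b\<^sub>0 - x"
      then have "lex_le u (uexp x (c x) 0)"
        unfolding u_def using x l by (intro uexp_mono[OF p]) auto
      with neg show False by simp
    qed
    then have less: "c x < a\<^sub>0 + b\<^sub>0 - x" using c[OF x] by simp
    have "eventually (\<lambda>a. \<forall>k<Suc N. uexp x a 0 k = uexp x (c x) 0 k) (at_right (c x))"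
      by (rule uexp_tendsto_right[OF tendsto_const _ tendsto_const region[OF x c[OF x]]])
        (auto simp: eventually_at_filter)
    moreover have "eventually (\<lambda>a. c x < a \<and> a < a\<^sub>0 + b\<^sub>0 - x) (at_right (c x))"
      using less by (auto intro!: eventually_at_rightI[of _ "a\<^sub>0 + b\<^sub>0 - x"])
    ultimately have "eventually (\<lambda>a. (\<forall>k<Suc N. uexp x a 0 k = uexp x (c x) 0 k) \<and>
        c x < a \<and> a < a\<^sub>0 + b\<^sub>0 - x) (at_right (c x))" by eventually_elim auto
    then obtain a where a: "\<forall>k<Suc N. uexp x a 0 k = uexp x (c x) 0 k" "c x < a" "a < a\<^sub>0 + b\<^sub>0 - x"
      using eventually_happens by fastforce
    have "lex_less (uexp x a 0) u"
      by (rule lex_less_cong_prefix[OF _ N]) (use a in auto)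
    then have "a \<in> S x" using a c[OF x] by (auto simp: S_def)
    then have "a \<le> c x" unfolding c_def by (rule cSup_upper[OF _ bdd])
    with a show False by simp
  qed
  \<comment> \<open>Without a hit the expansion of 0 is also continuous from the left, so exceeding
    \<open>u\<close> at the supremum would persist to members of \<open>S x\<close>.\<close>
  have no_hit: "uexp x (c x) 0 = u" if x: "l < x" "x < b\<^sub>0" and nh: "\<not> hits x (c x)" for x
  proof (rule ccontr)
    assume "\<not> ?thesis"
    with upper[OF x] have less: "lex_less u (uexp x (c x) 0)" by (auto simp: lex_le_def)
    then obtain N where N: "\<forall>i<N. u i = uexp x (c x) 0 i" "u N < uexp x (c x) 0 N"
      by (auto simp: lex_less_def)
    have "c x \<notin> S x" using less by (auto simp: S_def)
    moreover have "eventually (\<lambda>a. \<forall>k<Suc N. uexp x a 0 k = uexp x (c x) 0 k) (at_left (c x))"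
      by (intro uexp_0_tendsto tendsto_const tendsto_ident_at nh)
    ultimately obtain a where a: "a \<in> S x" "\<forall>k<Suc N. uexp x a 0 k = uexp x (c x) 0 k"
      using approx[OF x] by blast
    have "lex_less u (uexp x a 0)"
      by (rule lex_less_cong_prefix'[OF _ N]) (use a in auto)
    with a show False by (auto simp: S_def)
  qed
  \<comment> \<open>By reflection the expansion of 1 is left-continuous in \<open>a\<close>, so at
    \<open>c x\<close> it inherits the bound from members of \<open>S x\<close>.\<close>
  have lower: "lex_le (lexp x (c x) 1) v" if x: "l < x" "x < b\<^sub>0" for x
  proof (cases "c x \<in> S x")
    case True
    from slope[OF x True] show ?thesis by simp
  next
    case False
    show ?thesis
    proof (rule ccontr)
      assume "\<not> ?thesis"
      then obtain N where N: "\<forall>i<N. v i = lexp x (c x) 1 i" "v N < lexp x (c x) 1 N"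
        by (auto simp: lex.not_le lex_less_def)
      have "eventually (\<lambda>a. \<forall>k<Suc N. uexp x (2 - x - a) 0 k = uexp x (2 - x - c x) 0 k) (at_left (c x))"
        by (rule uexp_tendsto_right[OF tendsto_const _ tendsto_const
              param_region_reflect[OF region[OF x c[OF x]]]])
          (auto simp: eventually_at_filter intro!: tendsto_intros)
      then have "eventually (\<lambda>a. \<forall>k<Suc N. lexp x a 1 k = lexp x (c x) 1 k) (at_left (c x))"
        by eventually_elim (simp add: lexp_def flip_def)
      then obtain a where a: "a \<in> S x" "\<forall>k<Suc N. lexp x a 1 k = lexp x (c x) 1 k"
        using approx[OF x False] by blast
      have "lex_less v (lexp x a 1)"
        by (rule lex_less_cong_prefix'[OF _ N]) (use a in auto)
      with slope[OF x a(1)] show False by (simp add: lex.less_asym)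
    qed
  qed
  have "continuous_on {l<..<b\<^sub>0} c"
  proof (rule continuous_on_of_monotone_bounds)
    fix x y assume "x \<in> {l<..<b\<^sub>0}" "y \<in> {l<..<b\<^sub>0}" and "x < y"
    then have x: "l < x" "x < b\<^sub>0" and y: "l < y" "y < b\<^sub>0" by auto
    have "S y \<subseteq> S x"
    proof
      fix a assume a: "a \<in> S y"
      have "lex_le (uexp x a 0) (uexp y a 0)"
        using x y a \<open>x < y\<close> l by (intro uexp_mono region) (auto simp: S_def)
      also have "lex_le (uexp y a 0) u" using a by (simp add: S_def)
      finally show "a \<in> S x" using a \<open>x < y\<close> by (auto simp: S_def)
    qed
    then have "c y \<le> c x" unfolding c_def using mem[OF y] bdd by (intro cSup_subset_mono) auto
    moreover have "c x \<le> c y + (y - x)"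
      unfolding c_def[of x]
    proof (rule cSup_least)
      fix a assume a: "a \<in> S x"
      show "a \<le> c y + (y - x)"
      proof (rule ccontr)
        assume neg: "\<not> ?thesis"
        \<comment> \<open>Going to the larger slope \<open>y\<close> along constant
          \<open>a + b\<close> does not raise the expansion of 0.\<close>
        define a' where "a' = a - (y - x)"
        have a': "c y < a'" "a\<^sub>0 \<le> a'" "a' \<le> a\<^sub>0 + b\<^sub>0 - y"
          using neg c[OF y] a by (auto simp: a'_def S_def)
        have "lex_le (uexp y a' 0) (uexp x a 0)"
          using x l \<open>x < y\<close> by (intro uexp_mono region y a') (auto simp: a'_def)
        also have "lex_le (uexp x a 0) u" using a by (simp add: S_def)
        finally have "a' \<in> S y" using a' by (simp add: S_def)
        then have "a' \<le> c y" unfolding c_def by (rule cSup_upper[OF _ bdd])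
        with a' show False by simp
      qed
    qed (use mem[OF x] in auto)
    ultimately show "c y \<le> c x \<and> c x \<le> c y + (y - x)" by simp
  qed
  with c upper lower no_hit show ?thesis unfolding u_def v_def by blast
qed

text \<open>A hit of one end point on the curve is kept by \<open>hits_nearby\<close>, which adds
  the hit of the other. In that second step one bounding word stays fixed while the slope drops, so
  by \<open>slope_le\<close> the other one cannot move outward.\<close>

lemma param_approximation:
  assumes p: "(b\<^sub>0, a\<^sub>0) \<in> param_region" and l: "1 \<le> l" "l < b\<^sub>0"
  obtains b a where "l < b" "b < b\<^sub>0" "a\<^sub>0 \<le> a" "a \<le> a\<^sub>0 + b\<^sub>0 - b" "hits b a" "hits b (2 - b - a)"
    "lex_le (uexp b\<^sub>0 a\<^sub>0 0) (uexp b a 0)" "lex_le (lexp b a 1) (lexp b\<^sub>0 a\<^sub>0 1)"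
proof -
  note pD = param_regionD[OF p]
  obtain c where cont: "continuous_on {l<..<b\<^sub>0} c"
    and c: "\<And>x. l < x \<Longrightarrow> x < b\<^sub>0 \<Longrightarrow> a\<^sub>0 \<le> c x \<and> c x \<le> a\<^sub>0 + b\<^sub>0 - x"
    and u: "\<And>x. l < x \<Longrightarrow> x < b\<^sub>0 \<Longrightarrow> lex_le (uexp b\<^sub>0 a\<^sub>0 0) (uexp x (c x) 0)"
    and v: "\<And>x. l < x \<Longrightarrow> x < b\<^sub>0 \<Longrightarrow> lex_le (lexp x (c x) 1) (lexp b\<^sub>0 a\<^sub>0 1)"
    and nh: "\<And>x. l < x \<Longrightarrow> x < b\<^sub>0 \<Longrightarrow> \<not> hits x (c x) \<Longrightarrow> uexp x (c x) 0 = uexp b\<^sub>0 a\<^sub>0 0"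
    using curve_exists[OF p l] by blast
  have region: "(x, a) \<in> param_region" if "l < x" "x < b\<^sub>0" "a\<^sub>0 \<le> a" "a \<le> a\<^sub>0 + b\<^sub>0 - x" for x a
    using that l pD by (intro param_regionI) auto
  show thesis
  proof (cases "\<exists>x. l < x \<and> x < b\<^sub>0 \<and> hits x (c x)")
    case True
    then obtain x where x: "l < x" "x < b\<^sub>0" "hits x (c x)" by blast
    have px: "(x, c x) \<in> param_region" using region x c by blast
    from hits_nearby[OF px x(3) l(1) x(1)] obtain b a where
      ba: "l < b" "b < x" "c x \<le> a" "a \<le> c x + x - b" "hits b a" "hits b (2 - b - a)"
      and u_eq: "uexp b a 0 = uexp x (c x) 0" by metis
    have pb: "(b, a) \<in> param_region" using ba x c[of x] by (intro region) auto
    have "lex_le (lexp b a 1) (lexp x (c x) 1)"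
    proof (rule ccontr)
      assume "\<not> ?thesis"
      then have "x \<le> b" using u_eq by (intro slope_le[OF pb px]) auto
      with ba show False by simp
    qed
    with v[OF x(1,2)] have "lex_le (lexp b a 1) (lexp b\<^sub>0 a\<^sub>0 1)" by (rule lex.order_trans[rotated])
    with ba x c[of x] u[of x] u_eq show thesis by (intro that[of b a]) auto
  next
    case False
    \<comment> \<open>Here the expansion of 0 is constant along the curve, so the orbit of 1 must
      hit somewhere; the first case is then repeated in the reflected system.\<close>
    have "\<exists>x. l < x \<and> x < b\<^sub>0 \<and> hits x (2 - x - c x)"
      by (rule curve_hits[OF l(2) cont]) (use region c nh False in blast)+
    then obtain x where x: "l < x" "x < b\<^sub>0" "hits x (2 - x - c x)" by blast
    have px: "(x, c x) \<in> param_region" using region x c by blast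
    from hits_nearby[OF param_region_reflect[OF px] x(3) l(1) x(1)] obtain b a' where
      ba': "l < b" "b < x" "2 - x - c x \<le> a'" "a' \<le> 2 - x - c x + x - b" "hits b a'"
      "hits b (2 - b - a')" and u_eq: "uexp b a' 0 = uexp x (2 - x - c x) 0" by metis
    define a where "a = 2 - b - a'"
    have a': "a' = 2 - b - a" by (simp add: a_def)
    have ba: "l < b" "b < x" "c x \<le> a" "a \<le> c x + x - b" "hits b a" "hits b (2 - b - a)"
      using ba' by (auto simp: a_def)
    have pb: "(b, a) \<in> param_region" using ba x c[of x] by (intro region) auto
    have v_eq: "lexp b a 1 = lexp x (c x) 1" using u_eq by (simp add: lexp_def a')
    have "lex_le (uexp x (c x) 0) (uexp b a 0)"
    proof (rule ccontr)
      assume "\<not> ?thesis"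
      then have "x \<le> b" using v_eq by (intro slope_le[OF pb px]) auto
      with ba show False by simp
    qed
    with u[OF x(1,2)] have "lex_le (uexp b\<^sub>0 a\<^sub>0 0) (uexp b a 0)" by (rule lex.order_trans)
    with ba x c[of x] v[of x] v_eq show thesis by (intro that[of b a]) auto
  qed
qed

section \<open>Subshifts of finite type\<close>

text \<open>By periodicity of \<open>u\<close>, a violation found after some full periods is a
  violation within the first period for a later shift of \<open>w\<close>.\<close>

lemma periodic_lower_bound:
  assumes per: "shift (Suc n) u = u"
  shows "(\<forall>k. lex_le u (shift k w)) \<longleftrightarrow>
    (\<forall>k. \<not> (\<exists>j\<le>n. (\<forall>i<j. w (k + i) = u i) \<and> w (k + j) < u j))"
proof (intro iffI allI notI)
  fix k
  assume le: "\<forall>k. lex_le u (shift k w)" and "\<exists>j\<le>n. (\<forall>i<j. w (k + i) = u i) \<and> w (k + j) < u j"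
  then have "lex_less (shift k w) u" by (auto simp: lex_less_def shift_def)
  with le show False by (meson lex.leD)
next
  fix k
  assume no: "\<forall>k. \<not> (\<exists>j\<le>n. (\<forall>i<j. w (k + i) = u i) \<and> w (k + j) < u j)"
  show "lex_le u (shift k w)"
  proof (rule ccontr)
    assume "\<not> ?thesis"
    then obtain j where j: "\<forall>i<j. w (k + i) = u i" "w (k + j) < u j"
      by (auto simp: lex.not_le lex_less_def shift_def)
    define q r where "q = Suc n * (j div Suc n)" and "r = j mod Suc n"
    have jqr: "j = q + r" by (simp only: q_def r_def mult_div_mod_eq)
    have r: "r \<le> n" by (simp add: r_def less_Suc_eq_le[symmetric])
    have "shift (Suc n * m) u = u" for m
    proof (induction m)
      case (Suc m)
      have "shift (Suc n * Suc m) u = shift (Suc n * m) (shift (Suc n) u)" by simp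
      with Suc per show ?case by metis
    qed simp
    then have u: "u (q + i) = u i" for i
      unfolding q_def by (metis shift_def)
    have "(\<forall>i<r. w (k + q + i) = u i) \<and> w (k + q + r) < u r"
    proof (intro conjI allI impI)
      fix i assume "i < r"
      then have "w (k + (q + i)) = u (q + i)" using j(1) jqr by simp
      then show "w (k + q + i) = u i" using u by (simp add: add.assoc)
    next
      show "w (k + q + r) < u r" using j(2) u[of r] jqr by (simp add: add.assoc)
    qed
    with no r show False by blast
  qed
qed

lemma periodic_upper_bound:
  assumes per: "shift (Suc n) v = v" and full: "v \<in> full_shift" "w \<in> full_shift"
  shows "(\<forall>k. lex_le (shift k w) v) \<longleftrightarrow>
    (\<forall>k. \<not> (\<exists>j\<le>n. (\<forall>i<j. w (k + i) = v i) \<and> v j < w (k + j)))"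
proof -
  have "shift (Suc n) (flip v) = flip v" using per by (simp add: shift_flip)
  moreover have "flip w i = flip v j \<longleftrightarrow> w i = v j" "flip w i < flip v j \<longleftrightarrow> v j < w i" for i j
    using full_shiftD[OF full(2), of i] full_shiftD[OF full(1), of j] by (auto simp: flip_def)
  ultimately show ?thesis
    using periodic_lower_bound[of n "flip v" "flip w"]
    by (simp add: shift_flip lex_le_flip shift_full_shift full)
qed

text \<open>Turns a condition on the first \<open>N + 1\<close> digits into a set of forbidden
  words. In \<open>P ((!) s)\<close> the list is read as a sequence; the assumption on
  \<open>P\<close> restricts its view to the letters of \<open>s\<close>.\<close>

lemma avoids_words_iff:
  assumes w: "w \<in> full_shift"
    and P: "\<And>x y. (\<And>i. i \<le> N \<Longrightarrow> x i = y i) \<Longrightarrow> P x \<Longrightarrow> P y"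
  shows "(\<forall>s\<in>{s. set s \<subseteq> {0, 1} \<and> length s = Suc N \<and> P ((!) s)}. \<not> occurs_in s w) \<longleftrightarrow>
    (\<forall>k. \<not> P (shift k w))"
proof (intro iffI allI notI ballI)
  fix k
  assume avoid: "\<forall>s\<in>{s. set s \<subseteq> {0, 1} \<and> length s = Suc N \<and> P ((!) s)}. \<not> occurs_in s w"
    and k: "P (shift k w)"
  define s where "s = map (shift k w) [0..<Suc N]"
  have len: "length s = Suc N" by (simp add: s_def)
  have s: "s ! i = shift k w i" if "i \<le> N" for i
    using that unfolding s_def by (subst nth_map) (auto simp del: upt_Suc)
  have digits: "set s \<subseteq> {0, 1}"
  proof
    fix x assume "x \<in> set s"
    then obtain i where "x = shift k w i" unfolding s_def set_map by (rule imageE)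
    then show "x \<in> {0, 1}" using full_shiftD[OF shift_full_shift[OF w], of k i] by simp
  qed
  have Ps: "P ((!) s)" by (rule P[OF _ k]) (simp add: s)
  have occ: "occurs_in s w"
    unfolding occurs_in_def using s len by (intro exI[of _ k]) (simp add: shift_def)
  have "s \<in> {s. set s \<subseteq> {0, 1} \<and> length s = Suc N \<and> P ((!) s)}"
    using digits len Ps by simp
  with avoid occ show False by (elim ballE[of _ _ s] notE)
next
  fix s
  assume no: "\<forall>k. \<not> P (shift k w)"
    and s: "s \<in> {s. set s \<subseteq> {0, 1} \<and> length s = Suc N \<and> P ((!) s)}"
    and "occurs_in s w"
  from \<open>occurs_in s w\<close> obtain k where k: "\<forall>i<length s. w (k + i) = s ! i"
    unfolding occurs_in_def ..
  from s have len: "length s = Suc N" and Ps: "P ((!) s)" by simp_all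
  have "P (shift k w)" by (rule P[OF _ Ps]) (simp add: shift_def k len)
  with no show False by simp
qed

lemma subshift_of_finite_type_kneading_shift:
  assumes per: "shift (Suc m) u = u" "shift (Suc n) v = v" and full: "u \<in> full_shift" "v \<in> full_shift"
  shows "subshift_of_finite_type (kneading_shift u v)"
proof -
  define P Q where "P x \<longleftrightarrow> (\<exists>j\<le>m. (\<forall>i<j. x i = u i) \<and> x j < u j)"
    and "Q x \<longleftrightarrow> (\<exists>j\<le>n. (\<forall>i<j. x i = v i) \<and> v j < x j)" for x :: "nat \<Rightarrow> nat"
  have P: "P y" if "\<And>i. i \<le> m \<Longrightarrow> x i = y i" "P x" for x y
    using that unfolding P_def by (metis le_trans less_imp_le)
  have Q: "Q y" if "\<And>i. i \<le> n \<Longrightarrow> x i = y i" "Q x" for x y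
    using that unfolding Q_def by (metis le_trans less_imp_le)
  define A where "A = {s. set s \<subseteq> {0, 1} \<and> length s = Suc m \<and> P ((!) s)}"
  define B where "B = {s. set s \<subseteq> {0, 1} \<and> length s = Suc n \<and> Q ((!) s)}"
  have fin: "finite {s. set s \<subseteq> {0, 1::nat} \<and> length s = N}" for N
    by (rule finite_lists_length_eq) simp
  have "finite A" by (rule finite_subset[OF _ fin[of "Suc m"]]) (auto simp: A_def)
  moreover have "finite B" by (rule finite_subset[OF _ fin[of "Suc n"]]) (auto simp: B_def)
  moreover have "kneading_shift u v = {w \<in> full_shift. \<forall>s\<in>A \<union> B. \<not> occurs_in s w}"
  proof -
    have "(\<forall>k. lex_le u (shift k w)) \<longleftrightarrow> (\<forall>s\<in>A. \<not> occurs_in s w)" if w: "w \<in> full_shift" for w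
    proof -
      have "(\<forall>k. lex_le u (shift k w)) \<longleftrightarrow> (\<forall>k. \<not> P (shift k w))"
        unfolding periodic_lower_bound[OF per(1)] P_def by (simp add: shift_def)
      also have "\<dots> \<longleftrightarrow> (\<forall>s\<in>A. \<not> occurs_in s w)"
        unfolding A_def by (rule avoids_words_iff[OF w P, symmetric])
      finally show ?thesis .
    qed
    moreover have "(\<forall>k. lex_le (shift k w) v) \<longleftrightarrow> (\<forall>s\<in>B. \<not> occurs_in s w)" if w: "w \<in> full_shift" for w
    proof -
      have "(\<forall>k. lex_le (shift k w) v) \<longleftrightarrow> (\<forall>k. \<not> Q (shift k w))"
        unfolding periodic_upper_bound[OF per(2) full(2) w] Q_def by (simp add: shift_def)
      also have "\<dots> \<longleftrightarrow> (\<forall>s\<in>B. \<not> occurs_in s w)"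
        unfolding B_def by (rule avoids_words_iff[OF w Q, symmetric])
      finally show ?thesis .
    qed
    ultimately show ?thesis unfolding kneading_shift_def by blast
  qed
  moreover have "\<forall>s\<in>A \<union> B. set s \<subseteq> {0, 1}" by (auto simp: A_def B_def)
  ultimately show ?thesis
    unfolding subshift_of_finite_type_def by (intro exI[of _ "A \<union> B"] conjI finite_UnI)
qed

lemma hits_imp_subshift_of_finite_type:
  assumes p: "(b, a) \<in> param_region" and "hits b a" "hits b (2 - b - a)"
  shows "subshift_of_finite_type (beta_shift b a)"
proof -
  obtain m n where "shift (Suc m) (uexp b a 0) = uexp b a 0"
    and n: "shift (Suc n) (uexp b (2 - b - a) 0) = uexp b (2 - b - a) 0"
    using hits_imp_periodic assms by meson
  moreover have "shift (Suc n) (lexp b a 1) = lexp b a 1"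
    using n by (simp add: lexp_def shift_flip)
  ultimately show ?thesis
    unfolding beta_shift_eq_kneading_shift[OF p]
    by (intro subshift_of_finite_type_kneading_shift) auto
qed

section \<open>Hausdorff convergence\<close>

lemma shift_dist_bounds: "0 \<le> shift_dist v w" "shift_dist v w \<le> 1"
  by (auto simp: shift_dist_def)

lemma shift_dist_le:
  assumes "\<forall>k<N. v k = w k"
  shows "shift_dist v w \<le> 1 / 2 ^ N"
proof (cases "v = w")
  case False
  then have "\<exists>n. v n \<noteq> w n" by auto
  then have "v (LEAST n. v n \<noteq> w n) \<noteq> w (LEAST n. v n \<noteq> w n)" by (rule LeastI_ex)
  with assms have "N \<le> (LEAST n. v n \<noteq> w n)" by (meson not_le)
  with False show ?thesis by (simp add: shift_dist_def field_simps)
qed (simp add: shift_dist_def)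

text \<open>As \<open>Y\<close> is contained in \<open>X\<close>, only the distances from points of
  \<open>X\<close> to \<open>Y\<close> contribute; the other supremum is 0.\<close>

lemma hausdorff_dist_le:
  assumes "Y \<noteq> {}" "Y \<subseteq> X" and near: "\<And>v. v \<in> X \<Longrightarrow> \<exists>w\<in>Y. \<forall>k<N. v k = w k"
  shows "0 \<le> hausdorff_dist X Y" "hausdorff_dist X Y \<le> 1 / 2 ^ N"
proof -
  have bdd: "bdd_below ((\<lambda>w. shift_dist v w) ` Z)" "bdd_below ((\<lambda>w. shift_dist w v) ` Z)" for v Z
    using shift_dist_bounds by (auto intro!: bdd_belowI2[of _ 0])
  have zero: "(INF v\<in>X. shift_dist v w) = 0" if "w \<in> Y" for w
  proof (rule antisym)
    have "(INF v\<in>X. shift_dist v w) \<le> shift_dist w w"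
      using that assms(2) bdd by (intro cINF_lower) auto
    then show "(INF v\<in>X. shift_dist v w) \<le> 0" by (simp add: shift_dist_def)
    show "0 \<le> (INF v\<in>X. shift_dist v w)"
      using assms(1,2) shift_dist_bounds by (intro cINF_greatest) auto
  qed
  have "(SUP w\<in>Y. INF v\<in>X. shift_dist v w) = (SUP w\<in>Y. 0)"
    by (intro SUP_cong refl zero)
  also have "\<dots> = 0" using assms(1) by simp
  finally have 1: "(SUP w\<in>Y. INF v\<in>X. shift_dist v w) = 0" .
  have 2: "(SUP v\<in>X. INF w\<in>Y. shift_dist v w) \<le> 1 / 2 ^ N"
  proof (rule cSUP_least)
    fix v assume "v \<in> X"
    then obtain w where w: "w \<in> Y" "\<forall>k<N. v k = w k" using near by blast
    have "(INF w\<in>Y. shift_dist v w) \<le> shift_dist v w"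
      using w bdd by (intro cINF_lower) auto
    with shift_dist_le[OF w(2)] show "(INF w\<in>Y. shift_dist v w) \<le> 1 / 2 ^ N" by linarith
  qed (use assms in auto)
  show "0 \<le> hausdorff_dist X Y" "hausdorff_dist X Y \<le> 1 / 2 ^ N"
    unfolding hausdorff_dist_def using 1 2 by auto
qed

text \<open>A point slightly to the right of a given one has the same first digits, and its orbit avoids
  the discontinuity up to the corresponding time.\<close>

lemma generic_point:
  assumes p: "(b, a) \<in> param_region" and v: "v \<in> beta_shift b a"
  obtains x where "0 \<le> x" "x < 1" "\<forall>k<N. uexp b a x k = v k"
    "\<forall>k<N. b * (umap b a ^^ k) x + a \<noteq> 1"
proof -
  obtain y where y: "0 \<le> y" "y < 1" "\<forall>k<N. uexp b a y k = v k"
    using v unfolding beta_shift_eq_kneading_shift[OF p]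
  proof (rule kneading_shift_representation[OF p])
    fix y assume y: "0 < y" "y \<le> 1" "v = lexp b a y"
    have "eventually (\<lambda>z. 0 < z \<and> z < y) (at_left y)"
      using y by (auto intro!: eventually_at_leftI[of 0])
    with uexp_at_left[OF p, of N y]
    have "eventually (\<lambda>z. (\<forall>k<N. uexp b a z k = lexp b a y k) \<and> 0 < z \<and> z < y) (at_left y)"
      by eventually_elim auto
    then obtain z where "\<forall>k<N. uexp b a z k = lexp b a y k" "0 < z" "z < y"
      using eventually_happens by fastforce
    with y that[of z] show thesis by simp
  qed (use that in auto)
  have "eventually (\<lambda>x. y < x \<and> x < 1) (at_right y)"
    using y by (auto intro!: eventually_at_rightI[of _ 1])
  with uexp_at_right[OF p y(1,2), of N]
  have "eventually (\<lambda>x. (\<forall>k<N. uexp b a x k = uexp b a y k) \<and> y < x \<and> x < 1) (at_right y)"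
    by eventually_elim auto
  then obtain x where x: "\<forall>k<N. uexp b a x k = uexp b a y k" "y < x" "x < 1"
    using eventually_happens by fastforce
  have b: "0 < b" using param_regionD(1)[OF p] by simp
  have "b * (umap b a ^^ k) x + a \<noteq> 1" if k: "k < N" for k
  proof -
    have "(umap b a ^^ k) x - (umap b a ^^ k) y = b ^ k * (x - y)"
      using x k by (intro uorbit_diff) auto
    moreover have "0 < b ^ k * (x - y)" using b x by simp
    ultimately have "b * (umap b a ^^ k) y < b * (umap b a ^^ k) x" using b by simp
    moreover have "uexp b a x k = uexp b a y k" using x k by blast
    ultimately show ?thesis by (auto simp: uexp_def split: if_splits)
  qed
  with x y that[of x] show thesis by simp
qed

text \<open>Only finitely many prefixes of length \<open>N\<close> occur in the limit shift. Each
  occurs at a point whose orbit avoids the discontinuity up to that time, and there it persists for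
  nearby parameters; the inclusion settles the other half of the distance.\<close>

lemma hausdorff_dist_beta_shift_tendsto_0:
  assumes p: "(\<beta>, \<alpha>) \<in> param_region" and pn: "\<And>n. (b n, a n) \<in> param_region"
    and lim: "b \<longlonglongrightarrow> \<beta>" "a \<longlonglongrightarrow> \<alpha>"
    and sub: "\<And>n. beta_shift (b n) (a n) \<subseteq> beta_shift \<beta> \<alpha>"
  shows "(\<lambda>n. hausdorff_dist (beta_shift \<beta> \<alpha>) (beta_shift (b n) (a n))) \<longlonglongrightarrow> 0"
proof -
  have mem: "uexp (b n) (a n) x \<in> beta_shift (b n) (a n)" if "0 \<le> x" "x < 1" for n x
    using uexp_in_kneading_shift[OF pn that] beta_shift_eq_kneading_shift[OF pn] by simp
  then have ne: "beta_shift (b n) (a n) \<noteq> {}" for n by (metis empty_iff order.refl zero_less_one)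
  have near: "eventually (\<lambda>n. \<forall>v\<in>beta_shift \<beta> \<alpha>. \<exists>w\<in>beta_shift (b n) (a n). \<forall>k<N. v k = w k) sequentially"
    for N
  proof -
    define word where "word v = map v [0..<N]" for v :: "nat \<Rightarrow> nat"
    have word_eq: "word v = word w \<longleftrightarrow> (\<forall>k<N. v k = w k)" for v w
      by (auto simp: word_def list_eq_iff_nth_eq)
    have fin_words: "finite {s. set s \<subseteq> {0, 1::nat} \<and> length s = N}"
      by (rule finite_lists_length_eq) simp
    have words: "set (word v) \<subseteq> {0, 1}" if "v \<in> full_shift" for v
    proof
      fix x assume "x \<in> set (word v)"
      then obtain i where "x = v i" unfolding word_def set_map by (rule imageE)
      then show "x \<in> {0, 1}" using full_shiftD[OF that, of i] by simp
    qed
    have "word ` beta_shift \<beta> \<alpha> \<subseteq> {s. set s \<subseteq> {0, 1} \<and> length s = N}"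
    proof (intro image_subsetI CollectI conjI)
      fix v assume "v \<in> beta_shift \<beta> \<alpha>"
      then show "set (word v) \<subseteq> {0, 1}"
        unfolding beta_shift_eq_kneading_shift[OF p] kneading_shift_def by (intro words) simp
    qed (simp add: word_def)
    then have fin: "finite (word ` beta_shift \<beta> \<alpha>)" by (rule finite_subset[OF _ fin_words])
    have "eventually (\<lambda>n. \<forall>s\<in>word ` beta_shift \<beta> \<alpha>. \<exists>w\<in>beta_shift (b n) (a n). s = word w) sequentially"
    proof (rule eventually_ball_finite[OF fin], rule ballI)
      fix s assume "s \<in> word ` beta_shift \<beta> \<alpha>"
      then obtain v where v: "v \<in> beta_shift \<beta> \<alpha>" "s = word v" by blast
      obtain x where x: "0 \<le> x" "x < 1" "\<forall>k<N. uexp \<beta> \<alpha> x k = v k"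
        "\<forall>k<N. \<beta> * (umap \<beta> \<alpha> ^^ k) x + \<alpha> \<noteq> 1" using generic_point[OF p v(1), of N] by metis
      have "eventually (\<lambda>n. \<forall>k<N. uexp (b n) (a n) x k = uexp \<beta> \<alpha> x k) sequentially"
        by (intro uexp_tendsto lim tendsto_const x)
      then show "eventually (\<lambda>n. \<exists>w\<in>beta_shift (b n) (a n). s = word w) sequentially"
      proof eventually_elim
        case (elim n)
        with x(3) have "s = word (uexp (b n) (a n) x)" unfolding v(2) word_eq by simp
        then show ?case using mem[OF x(1,2)] by (rule bexI)
      qed
    qed
    then show ?thesis by eventually_elim (simp add: word_eq)
  qed
  show ?thesis
  proof (rule tendstoI)
    fix e :: real assume "0 < e"
    then obtain N where N: "(1 / 2) ^ N < e" using real_arch_pow_inv[of e "1/2"] by auto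
    from near[of N]
    show "eventually (\<lambda>n. dist (hausdorff_dist (beta_shift \<beta> \<alpha>) (beta_shift (b n) (a n))) 0 < e) sequentially"
    proof eventually_elim
      case (elim n)
      with hausdorff_dist_le[OF ne sub, of n N] N show ?case
        by (auto simp: power_divide)
    qed
  qed
qed

theorem corollary1p2:
  fixes \<beta> \<alpha> :: real
  assumes "(\<beta>, \<alpha>) \<in> param_region"
  shows "\<exists>(b :: nat \<Rightarrow> real) (a :: nat \<Rightarrow> real).
           (\<forall>n. (b n, a n) \<in> param_region) \<and>
           (\<lambda>n. (b n, a n)) \<longlonglongrightarrow> (\<beta>, \<alpha>) \<and>
           (\<forall>n. subshift_of_finite_type (beta_shift (b n) (a n))) \<and>
           (\<lambda>n. hausdorff_dist (beta_shift \<beta> \<alpha>) (beta_shift (b n) (a n))) \<longlonglongrightarrow> 0 \<and>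
           (\<forall>n. beta_shift (b n) (a n) \<subseteq> beta_shift \<beta> \<alpha>)"
proof -
  note pD = param_regionD[OF assms]
  \<comment> \<open>Slopes between \<open>l n\<close> and \<open>\<beta>\<close> are within
    \<open>1 / (n + 1)\<close> of \<open>\<beta>\<close>, and
    \<open>\<alpha> \<le> a n \<le> \<alpha> + \<beta> - b n\<close> then squeezes
    \<open>a n\<close>. The maximum keeps the slopes above 1.\<close>
  define l where "l n = max 1 (\<beta> - 1 / real (Suc n))" for n
  have l: "1 \<le> l n" "l n < \<beta>" for n using pD by (auto simp: l_def)
  have "\<exists>b a. l n < b \<and> b < \<beta> \<and> \<alpha> \<le> a \<and> a \<le> \<alpha> + \<beta> - b \<and> hits b a \<and> hits b (2 - b - a) \<and>
    lex_le (uexp \<beta> \<alpha> 0) (uexp b a 0) \<and> lex_le (lexp b a 1) (lexp \<beta> \<alpha> 1)" for n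
    using param_approximation[OF assms l] by metis
  then obtain b a where ba: "\<And>n. l n < b n" "\<And>n. b n < \<beta>" "\<And>n. \<alpha> \<le> a n" "\<And>n. a n \<le> \<alpha> + \<beta> - b n"
    and hits: "\<And>n. hits (b n) (a n)" "\<And>n. hits (b n) (2 - b n - a n)"
    and lex: "\<And>n. lex_le (uexp \<beta> \<alpha> 0) (uexp (b n) (a n) 0)"
      "\<And>n. lex_le (lexp (b n) (a n) 1) (lexp \<beta> \<alpha> 1)"
    by metis
  have region: "(b n, a n) \<in> param_region" for n
    using ba[of n] l[of n] pD by (intro param_regionI) auto
  have sub: "beta_shift (b n) (a n) \<subseteq> beta_shift \<beta> \<alpha>" for n
    using kneading_shift_mono[OF lex] by (simp add: beta_shift_eq_kneading_shift region assms)
  have close: "\<beta> - inverse (real (Suc n)) \<le> b n" for n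
    using ba(1)[of n] by (simp add: l_def inverse_eq_divide)
  have lim0: "(\<lambda>n. \<beta> - inverse (real (Suc n))) \<longlonglongrightarrow> \<beta> - 0"
    by (intro tendsto_intros LIMSEQ_inverse_real_of_nat)
  have b: "b \<longlonglongrightarrow> \<beta>"
    by (rule tendsto_sandwich[OF _ _ lim0[simplified] tendsto_const])
      (use close ba(2) in \<open>auto intro!: always_eventually less_imp_le\<close>)
  have "(\<lambda>n. \<alpha> + \<beta> - b n) \<longlonglongrightarrow> \<alpha> + \<beta> - \<beta>" by (intro tendsto_intros b)
  then have lim_a: "(\<lambda>n. \<alpha> + \<beta> - b n) \<longlonglongrightarrow> \<alpha>" by simp
  have a: "a \<longlonglongrightarrow> \<alpha>"
    by (rule tendsto_sandwich[OF _ _ tendsto_const lim_a]) (use ba in auto)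
  show ?thesis
    using region tendsto_Pair[OF b a] sub hits_imp_subshift_of_finite_type[OF region hits]
      hausdorff_dist_beta_shift_tendsto_0[OF assms region b a sub] by blast
qed

end
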